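(* (Bifurcation Corollary for Multiplicity Lists) Let $N$ be a $2p\times 2p$ real positive definite matrix with the SSSP, and let $\mathbf m_s(N)$ be its ordered symplectic multiplicity list. Then for each refinement $\mathbf m'$ of $\mathbf m_s(N)$ there is a positive definite matrix $N'$ with the SSSP such that $\mathcal G^L(N')=\mathcal G^L(N)$ and $\mathbf m_s(N')=\mathbf m'$. In particular, if all the symplectic eigenvalues of $N$ are equal, then $\mathcal G^L(N)$ allows every possible ordered symplectic multiplicity list; that is, for every ordered list $(m_1,\dots,m_q)$ of positive integers with sum $p$ there is a positive definite matrix $N'$ with labeled graph $\mathcal G^L(N)$ and $\mathbf m_s(N')=(m_1,\dots,m_q)$.
   Context: $\Omega=\begin{bmatrix}O&I_p\\ -I_p&O\end{bmatrix}$; a real $2p\times2p$ matrix $S$ is symplectic if $S^\top\Omega S=\Omega$. Positive definite matrices are real symmetric. By Williamson's theorem, for each $2p\times 2p$ positive definite $N$ there is a symplectic $S$ with $S^\top NS=D\oplus D$, $D$ a $p\times p$ diagonal matrix whose diagonal entries are positive and unique up to order; these are the symplectic eigenvalues of $N$, and the multiplicity of a symplectic eigenvalue is its number of occurrences on the diagonal of $D$. If the distinct symplectic eigenvalues of $N$ are $\lambda_1<\cdots<\lambda_q$, the ordered symplectic multiplicity list is $\mathbf m_s(N)=(m_1,\dots,m_q)$, $m_i$ being the multiplicity of $\lambda_i$. A refinement of $\mathbf m_s(N)$ is a list obtained by replacing each $m_i$ (in its place) by a list of positive integers, in any order, with sum $m_i$. Labeled graphs of order $2p$ are simple graphs on vertex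 set $\{1,\dots,2p\}$. The labeled graph $\mathcal G^L(N)$ of a positive definite $N=[n_{ij}]$ has edges $\{ij: i\ne j,\ n_{ij}\neq0\}$. For a labeled graph $G^L$, $\mathcal S(G^L)$ is the set of real symmetric matrices $A=[a_{ij}]$ such that for $i\ne j$, $a_{ij}\ne0$ if and only if $ij$ is an edge (diagonal entries arbitrary). $\mathfrak{sp}(2p)$ is the space of Hamiltonian matrices $\begin{bmatrix}R&E\\ F&-R^\top\end{bmatrix}$ with $R,E,F$ real $p\times p$ and $E,F$ symmetric. $\mathrm{Symm}(2p)$ is the space of real symmetric $2p\times2p$ matrices. A positive definite $2p\times 2p$ matrix $N$ has the Strong Symplectic Spectral Property (SSSP) if $$\{NM+M^\top N: M\in\mathfrak{sp}(2p)\}+\operatorname{Span}\mathcal S(\mathcal G^L(N))=\mathrm{Symm}(2p).$$ *)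

theory Defs
  imports "HOL-Analysis.Analysis" "HOL-Library.Multiset"
begin

text \<open>
  A \<open>2p \<times> 2p\<close> matrix is indexed by the sum type \<^typ>\<open>'p + 'p\<close> with \<open>p = CARD('p)\<close>; the label
  \<open>k \<le> p\<close> corresponds to the left summand and \<open>p + k\<close> to the right one, so that the \<open>2 \<times> 2\<close>
  block structure is visible in the type.
\<close>

type_synonym 'v sqmat = "real^'v^'v"

definition block_matrix ::
  "'p sqmat \<Rightarrow> 'p sqmat \<Rightarrow> 'p sqmat \<Rightarrow> 'p sqmat \<Rightarrow> ('p::finite + 'p) sqmat" where
  "block_matrix A B C D = (\<chi> i j. case i of
      Inl k \<Rightarrow> (case j of Inl l \<Rightarrow> A $ k $ l | Inr l \<Rightarrow> B $ k $ l)
    | Inr k \<Rightarrow> (case j of Inl l \<Rightarrow> C $ k $ l | Inr l \<Rightarrow> D $ k $ l))"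

definition diag_matrix :: "real^'p \<Rightarrow> 'p::finite sqmat" where
  "diag_matrix d = (\<chi> i j. if i = j then d $ i else 0)"

definition Omega :: "('p::finite + 'p) sqmat" where
  "Omega = block_matrix 0 (mat 1) (- mat 1) 0"

definition symplectic :: "('p::finite + 'p) sqmat \<Rightarrow> bool" where
  "symplectic S \<longleftrightarrow> transpose S ** Omega ** S = Omega"

definition Symm :: "'v::finite sqmat set" where
  "Symm = {A. transpose A = A}"

definition pos_def :: "'v::finite sqmat \<Rightarrow> bool" where
  "pos_def N \<longleftrightarrow> N \<in> Symm \<and> (\<forall>x. x \<noteq> 0 \<longrightarrow> x \<bullet> (N *v x) > 0)"

definition williamson_diagonal :: "('p::finite + 'p) sqmat \<Rightarrow> real^'p \<Rightarrow> bool" where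
  "williamson_diagonal N d \<longleftrightarrow> (\<forall>i. d $ i > 0) \<and>
     (\<exists>S. symplectic S \<and>
        transpose S ** N ** S = block_matrix (diag_matrix d) 0 0 (diag_matrix d))"

text \<open>
  By Williamson's theorem the following description determines a unique multiset whenever \<open>N\<close> is
  positive definite; for other matrices the value is irrelevant.
\<close>

definition symplectic_eigenvalues :: "('p::finite + 'p) sqmat \<Rightarrow> real multiset" where
  "symplectic_eigenvalues N =
     (THE E. \<exists>d. williamson_diagonal N d \<and> E = image_mset (\<lambda>i. d $ i) (mset_set UNIV))"

definition symplectic_mult_list :: "('p::finite + 'p) sqmat \<Rightarrow> nat list" where
  "symplectic_mult_list N =
     map (count (symplectic_eigenvalues N))
       (sorted_list_of_set (set_mset (symplectic_eigenvalues N)))"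

definition refinement :: "nat list \<Rightarrow> nat list \<Rightarrow> bool" where
  "refinement ms' ms \<longleftrightarrow> (\<exists>parts :: nat list list.
     ms' = concat parts \<and> map sum_list parts = ms \<and> (\<forall>xs\<in>set parts. \<forall>k\<in>set xs. k > 0))"

text \<open>A labeled graph is a simple graph whose vertex set is the whole index type; it is represented
  by its set of edges.\<close>

definition labeled_graph :: "'v::finite sqmat \<Rightarrow> 'v set set" where
  "labeled_graph N = {{i, j} | i j. i \<noteq> j \<and> N $ i $ j \<noteq> 0}"

definition graph_matrices :: "'v::finite set set \<Rightarrow> 'v sqmat set" where
  "graph_matrices G = {A \<in> Symm. \<forall>i j. i \<noteq> j \<longrightarrow> (A $ i $ j \<noteq> 0 \<longleftrightarrow> {i, j} \<in> G)}"

definition hamiltonian_matrices :: "('p::finite + 'p) sqmat set" where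
  "hamiltonian_matrices =
     {block_matrix R E F (- transpose R) | R E F. E \<in> Symm \<and> F \<in> Symm}"

definition SSSP :: "('p::finite + 'p) sqmat \<Rightarrow> bool" where
  "SSSP N \<longleftrightarrow> pos_def N \<and>
     {(N ** M + transpose M ** N) + B | M B.
        M \<in> hamiltonian_matrices \<and> B \<in> span (graph_matrices (labeled_graph N))} = Symm"

end

theory Submission
  imports Defs
begin

text \<open>
  The theorem is an inverse function argument. Let \<open>\<Omega>\<close> be the matrix of the symplectic form and let
  \<open>N = W\<^sup>T (D \<oplus> D) W\<close> with \<open>W\<close> symplectic be the Williamson form of \<open>N\<close>. Moving the entries of
  \<open>D\<close> slightly splits the symplectic eigenvalues in any prescribed way
  (\<open>refine_multiplicities\<close>), but the resulting matrix \<open>N'' = W\<^sup>T (D' \<oplus> D') W\<close> near \<open>N\<close> may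
  violate the zero pattern of \<open>N\<close>. A symplectic congruence \<open>N'' \<mapsto> T\<^sup>T N'' T\<close> keeps the symplectic eigenvalues,
  and the SSSP says precisely that, to first order at \<open>T = 1\<close>, such congruences together with changes
  inside the pattern fill the whole space of symmetric matrices. Hence some \<open>T\<close> near \<open>1\<close> returns
  \<open>N''\<close> to the pattern (\<open>symplectic_congruence_into_pattern\<close>). The new matrix is close to \<open>N\<close>, so its
  nonzero entries stay nonzero and the graph is unchanged; the SSSP survives because surjectivity of
  a linear map is an open condition (\<open>SSSP_open\<close>).

  Two devices keep the analysis elementary. The unknown \<open>T\<close> ranges over all matrices, not over the
  symplectic group: with \<open>B\<close> a symmetric matrix of the pattern, the single equation
  \<open>T\<^sup>T (N'' + \<Omega>) T = (N + B) + \<Omega>\<close> splits into its skew part, which says that \<open>T\<close> is symplectic, and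
  its symmetric part, which says that \<open>T\<^sup>T N'' T\<close> is \<open>N + B\<close>. This equation is polynomial in \<open>T\<close>,
  and the SSSP is equivalent to surjectivity of its linearization onto all square matrices
  (\<open>SSSP_iff_surjective\<close>). A linear right inverse of that linearization turns the equation into a
  fixed point problem on a ball, which Brouwer's theorem solves.

  Symplectic eigenvalues are well defined by Williamson's theorem: existence (\<open>williamson_exists\<close>) is
  a symplectic version of diagonalization by repeated maximization of a Rayleigh quotient, and
  uniqueness (\<open>symplectic_diagonal_unique\<close>) comes from comparing the entries of a symplectic
  matrix that intertwines the two squared diagonal matrices.
\<close>

section \<open>Matrix algebra\<close>

lemma bounded_bilinear_matrix_mult:
  "bounded_bilinear ((**) :: real^'n^'m \<Rightarrow> real^'k^'n \<Rightarrow> real^'k^'m)"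
  unfolding bilinear_conv_bounded_bilinear[symmetric] bilinear_def
  by (intro conjI allI linearI)
     (vector matrix_matrix_mult_def sum.distrib sum_distrib_left algebra_simps)+

lemmas matrix_mult_simps =
  bounded_bilinear.add_left[OF bounded_bilinear_matrix_mult]
  bounded_bilinear.add_right[OF bounded_bilinear_matrix_mult]
  bounded_bilinear.diff_left[OF bounded_bilinear_matrix_mult]
  bounded_bilinear.diff_right[OF bounded_bilinear_matrix_mult]
  bounded_bilinear.minus_left[OF bounded_bilinear_matrix_mult]
  bounded_bilinear.minus_right[OF bounded_bilinear_matrix_mult]

lemmas matrix_mult_scaleR =
  bounded_bilinear.scaleR_left[OF bounded_bilinear_matrix_mult]
  bounded_bilinear.scaleR_right[OF bounded_bilinear_matrix_mult]

lemma linear_transpose: "linear (transpose :: real^'n^'m \<Rightarrow> real^'m^'n)"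
  by (intro linearI) (vector transpose_def)+

lemmas transpose_simps =
  linear_add[OF linear_transpose] linear_diff[OF linear_transpose]
  linear_neg[OF linear_transpose] linear_scale[OF linear_transpose]

lemma inner_matrix_transpose: "x \<bullet> (A *v y) = (transpose A *v x) \<bullet> (y :: real^'n)"
  by (simp add: dot_lmul_matrix)

lemma matrix_vector_neg: "(- A) *v x = - (A *v x)" "A *v (- x) = - (A *v (x :: real^'n))"
  by (vector matrix_vector_mult_def sum_negf)+

lemma norm_matrix_sq: "(norm (A :: real^'n^'m))\<^sup>2 = (\<Sum>i\<in>UNIV. (norm (A $ i))\<^sup>2)"
  by (simp add: norm_vec_def[of A] L2_set_def sum_nonneg)

lemma norm_transpose: "norm (transpose (A :: real^'n^'m)) = norm A"
proof -
  have "(norm (transpose A))\<^sup>2 = (norm A)\<^sup>2"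
    unfolding norm_matrix_sq
    by (simp add: norm_vec_def L2_set_def sum_nonneg transpose_def) (rule sum.swap)
  then show ?thesis by (simp add: power2_eq_iff_nonneg)
qed

text \<open>
  The norm of \<open>real^'n^'m\<close> is the Frobenius norm, so this is the Cauchy-Schwarz inequality for
  each entry of the product, summed over all entries.
\<close>
lemma norm_matrix_mult_le: "norm ((A :: real^'n^'m) ** (B :: real^'k^'n)) \<le> norm A * norm B"
proof (rule power2_le_imp_le)
  have entry: "((A ** B) $ i $ j)\<^sup>2 \<le> (norm (A $ i))\<^sup>2 * (norm (transpose B $ j))\<^sup>2" for i j
  proof -
    have "(A ** B) $ i $ j = A $ i \<bullet> transpose B $ j"
      by (simp add: matrix_matrix_mult_def inner_vec_def transpose_def)
    then show ?thesis
      by (metis Cauchy_Schwarz_ineq power2_norm_eq_inner)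
  qed
  have "(norm (A ** B))\<^sup>2 = (\<Sum>i\<in>UNIV. \<Sum>j\<in>UNIV. ((A ** B) $ i $ j)\<^sup>2)"
    unfolding norm_matrix_sq by (simp add: norm_vec_def L2_set_def sum_nonneg)
  also have "\<dots> \<le> (\<Sum>i\<in>UNIV. \<Sum>j\<in>UNIV. (norm (A $ i))\<^sup>2 * (norm (transpose B $ j))\<^sup>2)"
    by (intro sum_mono entry)
  also have "\<dots> = (norm A)\<^sup>2 * (norm (transpose B))\<^sup>2"
    by (simp add: norm_matrix_sq sum_product)
  finally show "(norm (A ** B))\<^sup>2 \<le> (norm A * norm B)\<^sup>2"
    by (simp add: power_mult_distrib norm_transpose)
qed simp

lemma norm_congruence_le: "norm (transpose X ** Y ** X) \<le> norm X * norm Y * norm X"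
  for X Y :: "'v::finite sqmat"
proof -
  have "norm (transpose X ** Y ** X) \<le> norm (transpose X ** Y) * norm X"
    by (rule norm_matrix_mult_le)
  also have "\<dots> \<le> norm (transpose X) * norm Y * norm X"
    by (intro mult_right_mono norm_matrix_mult_le) simp
  finally show ?thesis
    by (simp add: norm_transpose)
qed

text \<open>
  This is what allows the symplectic condition on a matrix and the prescribed value of a congruence to
  be encoded in one matrix equation.
\<close>
lemma symmetric_plus_skew_unique:
  fixes A B :: "'v::finite sqmat"
  assumes "A + B = A' + B'" "transpose A = A" "transpose A' = A'" "transpose B = - B" "transpose B' = - B'"
  shows "A = A'" "B = B'"
proof -
  have "A - B = A' - B'"
    using arg_cong[OF assms(1), of transpose] assms(2-) by (simp add: transpose_simps)
  then have "(A + B) + (A - B) = (A' + B') + (A' - B')"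
    by (simp only: assms(1))
  then have "2 *\<^sub>R A = 2 *\<^sub>R A'"
    by (simp add: scaleR_2)
  then show "A = A'" by simp
  then show "B = B'" using assms(1) by simp
qed

lemma pos_def_congruence:
  assumes A: "pos_def A" and inv: "S ** T = mat 1"
  shows "pos_def (transpose T ** A ** T)"
proof -
  have "x \<bullet> ((transpose T ** A ** T) *v x) > 0" if "x \<noteq> 0" for x
  proof -
    have "S *v (T *v x) = x"
      by (simp add: matrix_vector_mul_assoc inv)
    then have "T *v x \<noteq> 0" using that by auto
    moreover have "x \<bullet> ((transpose T ** A ** T) *v x) = (T *v x) \<bullet> (A *v (T *v x))"
      by (simp add: inner_matrix_transpose[of x "transpose T"] flip: matrix_vector_mul_assoc
          del: transpose_matrix_vector)
    ultimately show ?thesis using A by (simp add: pos_def_def)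
  qed
  then show ?thesis
    using A by (simp add: pos_def_def Symm_def matrix_transpose_mul matrix_mul_assoc)
qed

section \<open>The symplectic form and the symplectic group\<close>

lemma sum_UNIV_Plus:
  "(\<Sum>x\<in>(UNIV :: ('a::finite + 'b::finite) set). h x) = (\<Sum>a\<in>UNIV. h (Inl a)) + (\<Sum>b\<in>UNIV. h (Inr b))"
  unfolding UNIV_Plus_UNIV[symmetric] by (subst sum.Plus) auto

lemma Omega_mult_row [simp]:
  "(Omega ** M) $ Inl k $ j = M $ Inr k $ j" "(Omega ** M) $ Inr k $ j = - M $ Inl k $ j"
  by (simp_all add: Omega_def block_matrix_def matrix_matrix_mult_def sum_UNIV_Plus mat_def
      if_distrib[of "\<lambda>x. x * _"] if_distrib[of uminus] cong: if_cong)

lemma Omega_entry: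
  "Omega $ Inl k $ Inl l = 0" "Omega $ Inl k $ Inr l = (if k = l then 1 else 0)"
  "Omega $ Inr k $ Inl l = (if k = l then - 1 else 0)" "Omega $ Inr k $ Inr l = 0"
  by (simp_all add: Omega_def block_matrix_def mat_def)

lemma Omega_square: "Omega ** Omega = - mat 1"
proof -
  have "(Omega ** Omega) $ i $ j = (- mat 1 :: ('a + 'a) sqmat) $ i $ j" for i j :: "'a + 'a"
    by (cases i; cases j) (auto simp: Omega_entry mat_def)
  then show ?thesis by (simp add: vec_eq_iff)
qed

lemma transpose_Omega: "transpose Omega = - Omega"
proof -
  have "transpose Omega $ i $ j = (- Omega :: ('a + 'a) sqmat) $ i $ j" for i j :: "'a + 'a"
    by (cases i; cases j) (auto simp: transpose_def Omega_entry)
  then show ?thesis by (simp add: vec_eq_iff)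
qed

lemma Omega_Omega_vector: "Omega *v (Omega *v x) = - x"
  by (simp add: matrix_vector_mul_assoc Omega_square matrix_vector_neg)

lemma inner_Omega: "x \<bullet> (Omega *v y) = - ((Omega *v x) \<bullet> y)"
  by (simp add: inner_matrix_transpose transpose_Omega matrix_vector_neg del: transpose_matrix_vector)

lemma inner_Omega_self: "x \<bullet> (Omega *v x) = 0"
  using inner_Omega[of x x] by (simp add: inner_commute)

lemma inner_Symm: "N \<in> Symm \<Longrightarrow> x \<bullet> (N *v y) = (N *v x) \<bullet> y"
  by (simp add: inner_matrix_transpose Symm_def del: transpose_matrix_vector)

lemma symplectic_mult:
  assumes "symplectic S" "symplectic T"
  shows "symplectic (S ** T)"
proof -
  have "transpose (S ** T) ** Omega ** (S ** T) = transpose T ** (transpose S ** Omega ** S) ** T"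
    by (simp add: matrix_transpose_mul matrix_mul_assoc)
  then show ?thesis
    using assms by (simp add: symplectic_def)
qed

lemma symplectic_left_inverse:
  assumes "symplectic S"
  shows "(- (Omega ** transpose S ** Omega)) ** S = mat 1"
proof -
  have "(- (Omega ** transpose S ** Omega)) ** S = - (Omega ** (transpose S ** Omega ** S))"
    by (simp add: matrix_mult_simps matrix_mul_assoc)
  also have "\<dots> = mat 1"
    using assms by (simp add: symplectic_def Omega_square)
  finally show ?thesis .
qed

lemma symplectic_inverse:
  assumes "symplectic S"
  obtains S' where "symplectic S'" "S ** S' = mat 1" "S' ** S = mat 1"
proof -
  obtain S' where inv: "S' ** S = mat 1" "S ** S' = mat 1"
    using symplectic_left_inverse[OF assms] matrix_left_right_inverse by blast
  have "transpose S' ** Omega ** S' = transpose S' ** (transpose S ** Omega ** S) ** S'"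
    using assms by (simp add: symplectic_def)
  also have "\<dots> = transpose (S ** S') ** Omega ** (S ** S')"
    by (simp add: matrix_transpose_mul matrix_mul_assoc)
  also have "\<dots> = Omega"
    by (simp add: inv)
  finally show thesis
    using inv that by (simp add: symplectic_def)
qed

text \<open>
  The transpose of a symplectic matrix is symplectic: the left inverse \<open>- \<Omega> S\<^sup>T \<Omega>\<close> of \<open>S\<close> is also a
  right inverse.
\<close>
lemma symplectic_transpose:
  assumes "symplectic S"
  shows "S ** Omega ** transpose S = Omega"
proof -
  have "S ** - (Omega ** transpose S ** Omega) = mat 1"
    using symplectic_left_inverse[OF assms] by (simp only: matrix_left_right_inverse[of S])
  then have "- (S ** Omega ** transpose S ** Omega) = mat 1"
    by (simp only: matrix_mult_simps matrix_mul_assoc)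
  then have "- (S ** Omega ** transpose S ** Omega) ** (- Omega) = - Omega"
    by simp
  then have "S ** Omega ** transpose S ** (Omega ** Omega) = - Omega"
    by (simp add: matrix_mult_simps matrix_mul_assoc)
  then show ?thesis
    by (simp add: Omega_square matrix_mult_simps)
qed

section \<open>Existence in Williamson's theorem\<close>

lemma nonneg_parabola_linear_coeff:
  fixes b c :: real
  assumes "\<And>t. 0 \<le> 2 * t * b + t\<^sup>2 * c" "0 \<le> c"
  shows "b = 0"
proof -
  define t where "t = - b / (c + 1)"
  have b: "b = - t * (c + 1)" using assms(2) by (simp add: t_def)
  have "0 \<le> 2 * t * b + t\<^sup>2 * c" by (rule assms)
  also have "\<dots> = - (t\<^sup>2 * (c + 2))"
    by (simp add: b algebra_simps power2_eq_square)
  finally have "t = 0"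
    using assms(2) by (simp add: mult_le_0_iff)
  then show ?thesis by (simp add: b)
qed

text \<open>
  A maximizer of the Rayleigh quotient of \<open>M\<close> against \<open>N\<close> on \<open>V\<close> is an eigenvector: if \<open>l\<close> is the maximum,
  the quadratic form \<open>l N - M\<close> is nonnegative on \<open>V\<close> and vanishes at the maximizer, so its first
  variation there is zero. Only test vectors in \<open>V\<close> are available, hence the weak form of the
  eigenvalue equation.
\<close>
lemma generalized_eigenvector_in_subspace:
  fixes M N :: "'v::finite sqmat"
  assumes N: "pos_def N" and M: "M \<in> Symm" and V: "subspace V" and ne: "\<exists>z\<in>V. z \<noteq> 0"
  obtains x l where "x \<in> V" "x \<noteq> 0" "\<And>z. z \<in> V \<Longrightarrow> z \<bullet> (M *v x) = l * (z \<bullet> (N *v x))"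
proof -
  let ?r = "\<lambda>x. (x \<bullet> (M *v x)) / (x \<bullet> (N *v x))"
  have Npos: "x \<bullet> (N *v x) > 0" if "x \<noteq> 0" for x
    using N that by (simp add: pos_def_def)
  have "compact (V \<inter> sphere 0 1)"
    by (rule closed_Int_compact) (simp_all add: closed_subspace V)
  moreover have "V \<inter> sphere 0 1 \<noteq> {}"
  proof -
    from ne obtain z where "z \<in> V" "z \<noteq> 0" by blast
    then have "(1 / norm z) *\<^sub>R z \<in> V \<inter> sphere 0 1"
      using V by (auto simp: subspace_scale)
    then show ?thesis by blast
  qed
  moreover have "continuous_on (V \<inter> sphere 0 1) ?r"
  proof (intro continuous_intros linear_continuous_on matrix_vector_mul_bounded_linear)
    show "\<forall>x\<in>V \<inter> sphere 0 1. x \<bullet> (N *v x) \<noteq> 0"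
      using Npos by (metis IntD2 less_irrefl mem_sphere_0 norm_zero zero_neq_one)
  qed
  ultimately obtain x where x: "x \<in> V \<inter> sphere 0 1" and
    max: "\<And>y. y \<in> V \<inter> sphere 0 1 \<Longrightarrow> ?r y \<le> ?r x"
    by (meson continuous_attains_sup)
  define l where "l = ?r x"
  define K where "K y z = l * (y \<bullet> (N *v z)) - y \<bullet> (M *v z)" for y z
  have "x \<noteq> 0" "x \<in> V" using x by auto
  have K0: "K x x = 0"
    using Npos[OF \<open>x \<noteq> 0\<close>] by (simp add: K_def l_def)
  have Knn: "0 \<le> K y y" if "y \<in> V" for y
  proof (cases "y = 0")
    case False
    have "(1 / norm y) *\<^sub>R y \<in> V \<inter> sphere 0 1"
      using False that V by (auto simp: subspace_scale)
    from max[OF this] have "?r y \<le> l"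
      using False by (simp add: l_def matrix_vector_mult_scaleR)
    then show ?thesis using Npos[OF False] by (simp add: K_def field_simps)
  qed (simp add: K_def)
  have Ksym: "K y z = K z y" for y z
    using inner_Symm[OF M, of y z] inner_Symm[of N y z] N
    by (simp add: K_def pos_def_def inner_commute)
  have "K z x = 0" if "z \<in> V" for z
  proof (rule nonneg_parabola_linear_coeff)
    fix t
    have "0 \<le> K (x + t *\<^sub>R z) (x + t *\<^sub>R z)"
      using V that \<open>x \<in> V\<close> by (intro Knn) (simp add: subspace_add subspace_scale)
    also have "\<dots> = K x x + t * K x z + t * K z x + t\<^sup>2 * K z z"
      by (simp add: K_def algebra_simps inner_simps power2_eq_square)
    finally show "0 \<le> 2 * t * K z x + t\<^sup>2 * K z z"
      by (simp add: K0 Ksym[of x z])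
  qed (use that Knn in auto)
  then show thesis
    using that[OF \<open>x \<in> V\<close> \<open>x \<noteq> 0\<close>, of l] by (simp add: K_def)
qed

text \<open>
  One pair \<open>e\<^sub>i, f\<^sub>i\<close> of columns of the diagonalizing matrix is found at a time. The relations
  \<open>N e\<^sub>i = d\<^sub>i \<Omega> f\<^sub>i\<close> and \<open>N f\<^sub>i = - d\<^sub>i \<Omega> e\<^sub>i\<close> make orthogonality to \<open>e\<^sub>i, f\<^sub>i\<close> for \<open>N\<close> the same as for
  \<open>\<Omega>\<close>, so the complement \<open>V\<close> of the pairs already found is the same for both forms and is mapped to
  itself by \<open>\<Omega> N\<close>. On \<open>V\<close> the operator \<open>- (\<Omega> N)\<^sup>2\<close> is self-adjoint and positive for the inner
  product given by \<open>N\<close>. An eigenvector \<open>u\<close> with eigenvalue \<open>\<mu>\<^sup>2\<close> and the vector \<open>- \<Omega> N u / \<mu>\<close> form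
  the next pair.
\<close>
lemma williamson_pairs:
  fixes N :: "('p::finite + 'p) sqmat" and I :: "'p set"
  assumes N: "pos_def N"
  shows "\<exists>(d :: 'p \<Rightarrow> real) e f.
     (\<forall>i\<in>I. d i > 0 \<and> N *v e i = d i *\<^sub>R (Omega *v f i) \<and> N *v f i = - d i *\<^sub>R (Omega *v e i)) \<and>
     (\<forall>i\<in>I. \<forall>j\<in>I. e i \<bullet> (Omega *v f j) = (if i = j then 1 else 0) \<and>
        e i \<bullet> (Omega *v e j) = 0 \<and> f i \<bullet> (Omega *v f j) = 0)"
  using finite[of I]
proof (induction I rule: finite_induct)
  case empty
  then show ?case by simp
next
  case (insert k I)
  obtain d :: "'p \<Rightarrow> real" and e f where
    IH1: "\<forall>i\<in>I. d i > 0 \<and> N *v e i = d i *\<^sub>R (Omega *v f i) \<and>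
      N *v f i = - d i *\<^sub>R (Omega *v e i)" and
    IH2: "\<forall>i\<in>I. \<forall>j\<in>I. e i \<bullet> (Omega *v f j) = (if i = j then 1 else 0) \<and>
      e i \<bullet> (Omega *v e j) = 0 \<and> f i \<bullet> (Omega *v f j) = 0"
    using insert.IH by (elim exE conjE) (rule that)
  have d: "d i > 0" and Ne: "N *v e i = d i *\<^sub>R (Omega *v f i)"
    and Nf: "N *v f i = - d i *\<^sub>R (Omega *v e i)" if "i \<in> I" for i
    using IH1 that by blast+
  have ef: "e i \<bullet> (Omega *v f j) = (if i = j then 1 else 0)" and ee: "e i \<bullet> (Omega *v e j) = 0"
    and ff: "f i \<bullet> (Omega *v f j) = 0" if "i \<in> I" "j \<in> I" for i j
    using IH2 that by blast+
  have NS: "N \<in> Symm" and Npos: "\<And>x. x \<noteq> 0 \<Longrightarrow> x \<bullet> (N *v x) > 0"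
    using N by (auto simp: pos_def_def)
  define W where "W = (\<lambda>i. Omega *v f i) ` I \<union> (\<lambda>i. Omega *v e i) ` I"
  define V where "V = {z. \<forall>w\<in>W. w \<bullet> z = 0}"
  have V: "subspace V"
    unfolding V_def subspace_def by (auto simp: inner_simps)
  have Vf: "(Omega *v f i) \<bullet> z = 0" and Ve: "(Omega *v e i) \<bullet> z = 0" if "z \<in> V" "i \<in> I" for z i
    using that by (auto simp: V_def W_def)
  \<comment> \<open>At most \<open>2 |I| < 2 p\<close> linear conditions define \<open>V\<close>.\<close>
  have "\<exists>z\<in>V. z \<noteq> 0"
  proof -
    have "card W \<le> card I + card I"
      unfolding W_def by (meson card_Un_le card_image_le finite add_mono order_trans)
    moreover have "card I < CARD('p)"
      using insert.hyps by (metis UNIV_I finite_code psubset_card_mono psubsetI subset_UNIV)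
    ultimately have "dim W < DIM(real^('p + 'p))"
      using dim_le_card'[of W] by (simp add: W_def)
    then obtain z where "z \<noteq> 0" "\<And>y. y \<in> span W \<Longrightarrow> orthogonal z y"
      using orthogonal_to_subspace_exists[of W] by blast
    then have "z \<in> V"
      by (auto simp: V_def orthogonal_def inner_commute intro: span_base)
    with \<open>z \<noteq> 0\<close> show ?thesis by blast
  qed
  define A where "A = Omega ** N"
  have A_vec: "A *v z = Omega *v (N *v z)" for z
    by (simp add: A_def matrix_vector_mul_assoc)
  have A_inner: "(Omega *v y) \<bullet> (A *v z) = y \<bullet> (N *v z)" for y z
    using inner_Omega[of "Omega *v y" "N *v z"] by (simp add: A_vec Omega_Omega_vector)
  have AV: "A *v z \<in> V" if "z \<in> V" for z
    using that d by (auto simp: V_def W_def A_inner inner_Symm[OF NS] Ne Nf)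
  \<comment> \<open>The form of \<open>M\<close> is \<open>N (A z, A z)\<close>, which equals \<open>- N (z, A (A z))\<close>.\<close>
  define M where "M = transpose A ** N ** A"
  have "M \<in> Symm"
    using NS by (simp add: M_def Symm_def matrix_transpose_mul matrix_mul_assoc)
  from generalized_eigenvector_in_subspace[OF N this V \<open>\<exists>z\<in>V. z \<noteq> 0\<close>]
  obtain x l where x: "x \<in> V" "x \<noteq> 0" and
    eig: "\<And>z. z \<in> V \<Longrightarrow> z \<bullet> (M *v x) = l * (z \<bullet> (N *v x))"
    by blast
  have M_inner: "z \<bullet> (M *v y) = (A *v z) \<bullet> (N *v (A *v y))" for z y
    unfolding M_def matrix_vector_mul_assoc[symmetric]
    by (subst inner_matrix_transpose) simp
  have M_inner': "z \<bullet> (M *v y) = - (z \<bullet> (N *v (A *v (A *v y))))" for z y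
    unfolding M_inner A_vec[of z] A_vec[of "A *v y"]
    by (simp add: inner_Symm[OF NS, of z] inner_Omega[of "N *v z"])
  have "Omega *v (A *v x) = - (N *v x)"
    by (simp add: A_vec Omega_Omega_vector)
  with Npos[OF x(2)] have "A *v x \<noteq> 0" by auto
  then have "l > 0"
    using Npos[of "A *v x"] Npos[OF x(2)] eig[OF x(1)] by (simp add: M_inner zero_less_mult_iff)
  have AAx: "A *v (A *v x) = - l *\<^sub>R x"
  proof -
    define w where "w = A *v (A *v x) + l *\<^sub>R x"
    have "w \<in> V" using x V AV by (simp add: w_def subspace_add subspace_scale)
    \<comment> \<open>The eigenvalue equation may be tested against \<open>w\<close> because \<open>V\<close> is invariant under \<open>A\<close>.\<close>
    then have "w \<bullet> (N *v w) = 0"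
      using eig[of w] by (simp add: w_def M_inner' algebra_simps inner_simps)
    then have "w = 0" using Npos[of w] by force
    then show ?thesis by (simp add: w_def add_eq_0_iff2)
  qed
  define \<mu> where "\<mu> = sqrt l"
  \<comment> \<open>The factor that gives \<open>N (u, u) = \<mu>\<close>, which is equivalent to \<open>\<Omega> (u, v) = 1\<close>.\<close>
  define c where "c = sqrt (\<mu> / (x \<bullet> (N *v x)))"
  define u where "u = c *\<^sub>R x"
  define v where "v = (- c / \<mu>) *\<^sub>R (A *v x)"
  have "\<mu> > 0" and \<mu>2: "\<mu> * \<mu> = l" using \<open>l > 0\<close> by (simp_all add: \<mu>_def)
  have uN: "u \<bullet> (N *v u) = \<mu>"
    using Npos[OF x(2)] \<open>\<mu> > 0\<close>
    by (simp add: u_def c_def matrix_vector_mult_scaleR power2_eq_square[symmetric] flip: mult.assoc)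
  have uV: "u \<in> V" and vV: "v \<in> V"
    using x AV V by (simp_all add: u_def v_def subspace_scale subspace_neg)
  have Nu: "N *v u = \<mu> *\<^sub>R (Omega *v v)"
    using \<open>\<mu> > 0\<close> \<open>Omega *v (A *v x) = - (N *v x)\<close>
    by (simp add: u_def v_def matrix_vector_mult_scaleR matrix_vector_neg)
  have Nv: "N *v v = - \<mu> *\<^sub>R (Omega *v u)"
  proof -
    have "Omega *v (A *v (A *v x)) = - (N *v (A *v x))"
      by (simp add: A_vec[of "A *v x"] Omega_Omega_vector)
    then have "N *v (A *v x) = l *\<^sub>R (Omega *v x)"
      by (simp add: AAx matrix_vector_neg matrix_vector_mult_scaleR)
    then show ?thesis
      using \<open>\<mu> > 0\<close> by (simp add: u_def v_def matrix_vector_mult_scaleR matrix_vector_neg \<mu>2[symmetric])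
  qed
  have uv: "u \<bullet> (Omega *v v) = 1"
    using uN \<open>\<mu> > 0\<close> by (simp add: Nu)
  define d' where "d' = d(k := \<mu>)"
  define e' where "e' = e(k := u)"
  define f' where "f' = f(k := v)"
  have old: "d' i = d i" "e' i = e i" "f' i = f i" if "i \<in> I" for i
    using that insert.hyps by (auto simp: d'_def e'_def f'_def)
  have new: "d' k = \<mu>" "e' k = u" "f' k = v"
    by (simp_all add: d'_def e'_def f'_def)
  have cross: "e i \<bullet> (Omega *v v) = 0" "e i \<bullet> (Omega *v u) = 0" "f i \<bullet> (Omega *v v) = 0"
    "u \<bullet> (Omega *v f i) = 0" "u \<bullet> (Omega *v e i) = 0" "v \<bullet> (Omega *v f i) = 0"
    if "i \<in> I" for i
    using Vf[OF uV that] Ve[OF uV that] Vf[OF vV that] Ve[OF vV that]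
    by (simp_all add: inner_Omega[of "e i"] inner_Omega[of "f i"] inner_commute)
  have "\<forall>i\<in>insert k I. d' i > 0 \<and> N *v e' i = d' i *\<^sub>R (Omega *v f' i) \<and>
      N *v f' i = - d' i *\<^sub>R (Omega *v e' i)"
    using \<open>\<mu> > 0\<close> Nu Nv d Ne Nf by (auto simp: old new)
  moreover have "e' i \<bullet> (Omega *v f' j) = (if i = j then 1 else 0) \<and>
        e' i \<bullet> (Omega *v e' j) = 0 \<and> f' i \<bullet> (Omega *v f' j) = 0"
    if "i \<in> insert k I" "j \<in> insert k I" for i j
    using that insert.hyps
    by (auto simp: old new uv ef ee ff cross inner_Omega_self)
  ultimately show ?case by blast
qed

lemma williamson_exists:
  fixes N :: "('p::finite + 'p) sqmat"
  assumes N: "pos_def N"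
  shows "\<exists>d. williamson_diagonal N d"
proof -
  obtain d :: "'p \<Rightarrow> real" and e f where
    pairs: "\<forall>i\<in>UNIV. d i > 0 \<and> N *v e i = d i *\<^sub>R (Omega *v f i) \<and>
      N *v f i = - d i *\<^sub>R (Omega *v e i)"
    "\<forall>i\<in>UNIV. \<forall>j\<in>UNIV. e i \<bullet> (Omega *v f j) = (if i = j then 1 else 0) \<and>
      e i \<bullet> (Omega *v e j) = 0 \<and> f i \<bullet> (Omega *v f j) = 0"
    using williamson_pairs[OF N, of UNIV] by (elim exE conjE) (rule that)
  have d: "d i > 0" and Ne: "N *v e i = d i *\<^sub>R (Omega *v f i)"
    and Nf: "N *v f i = - d i *\<^sub>R (Omega *v e i)" for i
    using pairs(1) by blast+
  have ef: "e i \<bullet> (Omega *v f j) = (if i = j then 1 else 0)" and ee: "e i \<bullet> (Omega *v e j) = 0"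
    and ff: "f i \<bullet> (Omega *v f j) = 0" for i j
    using pairs(2) by blast+
  define b where "b = case_sum e f"
  define S :: "('p + 'p) sqmat" where "S = (\<chi> i j. b j $ i)"
  have entry: "(transpose S ** A ** S) $ i $ j = b i \<bullet> (A *v b j)" for A :: "('p + 'p) sqmat" and i j
  proof -
    have "A *v b j = column j (A ** S)"
      by (simp add: vec_eq_iff S_def column_def matrix_vector_mult_def matrix_matrix_mult_def)
    moreover have "(transpose S ** B) $ i $ j = b i \<bullet> column j B" for B
      by (simp add: matrix_matrix_mult_def transpose_def column_def S_def inner_vec_def)
    ultimately show ?thesis
      by (simp only: matrix_mul_assoc[symmetric])
  qed
  have fe: "f i \<bullet> (Omega *v e j) = (if i = j then - 1 else 0)" for i j
    using ef[of j i] inner_Omega[of "f i" "e j"] by (auto simp: inner_commute)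
  have "transpose S ** Omega ** S = Omega"
  proof -
    have "(transpose S ** Omega ** S) $ i $ j = Omega $ i $ j" for i j
      unfolding entry
      by (cases i; cases j) (auto simp: b_def ef ee ff fe Omega_entry)
    then show ?thesis by (simp add: vec_eq_iff)
  qed
  moreover have "transpose S ** N ** S =
      block_matrix (diag_matrix (\<chi> i. d i)) 0 0 (diag_matrix (\<chi> i. d i))"
  proof -
    have "(transpose S ** N ** S) $ i $ j =
        block_matrix (diag_matrix (\<chi> i. d i)) 0 0 (diag_matrix (\<chi> i. d i)) $ i $ j" for i j
      unfolding entry
      by (cases i; cases j)
         (auto simp: b_def Ne Nf ef ee ff fe diag_matrix_def block_matrix_def)
    then show ?thesis by (simp add: vec_eq_iff)
  qed
  ultimately show ?thesis
    using d by (auto simp: williamson_diagonal_def symplectic_def intro!: exI[of _ "\<chi> i. d i"])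
qed

section \<open>Uniqueness of the symplectic eigenvalues\<close>

abbreviation doubled_diag :: "real^'p \<Rightarrow> ('p::finite + 'p) sqmat" where
  "doubled_diag d \<equiv> block_matrix (diag_matrix d) 0 0 (diag_matrix d)"

abbreviation doubled :: "real^'p \<Rightarrow> 'p::finite + 'p \<Rightarrow> real" where
  "doubled d \<equiv> case_sum (($) d) (($) d)"

lemma doubled_diag_entry: "doubled_diag d $ i $ j = (if i = j then doubled d i else 0)"
  by (cases i; cases j) (auto simp: block_matrix_def diag_matrix_def)

lemma doubled_diag_mult_entry:
  "(doubled_diag d ** A) $ i $ j = doubled d i * A $ i $ j"
  "(A ** doubled_diag d) $ i $ j = A $ i $ j * doubled d j"
  by (simp_all add: matrix_matrix_mult_def doubled_diag_entry
      if_distrib[of "\<lambda>x. x * _"] if_distrib[of "\<lambda>x. _ * x"] cong: if_cong)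

lemma doubled_diag_Omega: "doubled_diag d ** Omega = Omega ** doubled_diag d"
proof -
  have "(doubled_diag d ** Omega) $ i $ j = (Omega ** doubled_diag d) $ i $ j" for i j
    unfolding doubled_diag_mult_entry by (cases i; cases j) (auto simp: Omega_entry)
  then show ?thesis by (simp add: vec_eq_iff)
qed

text \<open>
  Some term of the Leibniz formula is nonzero.
\<close>
lemma det_nonzero_imp_transversal:
  fixes U :: "'v::finite sqmat"
  assumes "det U \<noteq> 0"
  obtains \<pi> where "bij \<pi>" "\<And>i. U $ i $ \<pi> i \<noteq> 0"
proof -
  obtain \<pi> where "\<pi> permutes UNIV" "of_int (sign \<pi>) * (\<Prod>i\<in>UNIV. U $ i $ \<pi> i) \<noteq> 0"
    using assms unfolding det_def by (metis (mono_tags, lifting) mem_Collect_eq sum.neutral)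
  then show thesis
    using that[of \<pi>] by (simp add: permutes_bij)
qed

text \<open>
  With \<open>U'\<close> the inverse of \<open>U\<close>, \<open>U\<^sup>T = \<Omega> U' \<Omega>\<^sup>T\<close>, so the congruence is a similarity of \<open>\<Omega> D'\<close> and \<open>\<Omega> D\<close>; as \<open>\<Omega>\<close>
  commutes with both doubled diagonal matrices, squaring gives \<open>U D'\<^sup>2 = D\<^sup>2 U\<close>. Hence a nonzero
  entry of \<open>U\<close> in row \<open>i\<close> and column \<open>j\<close> forces the \<open>i\<close>th diagonal entry of \<open>D\<close> to be equal to the
  \<open>j\<close>th diagonal entry of \<open>D'\<close>, and a transversal of nonzero entries matches the two diagonals
  bijectively.
\<close>
lemma symplectic_diagonal_unique:
  fixes d d' :: "real^'p::finite"
  assumes U: "symplectic U" and eq: "transpose U ** doubled_diag d ** U = doubled_diag d'"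
    and pos: "\<And>i. d $ i > 0" "\<And>i. d' $ i > 0"
  shows "image_mset (($) d) (mset_set UNIV) = image_mset (($) d') (mset_set UNIV)"
proof -
  let ?D = "doubled_diag d" and ?D' = "doubled_diag d'"
  have sq: "Omega ** doubled_diag a ** Omega ** doubled_diag a = - (doubled_diag a ** doubled_diag a)"
    for a :: "real^'p"
  proof -
    have "Omega ** doubled_diag a ** Omega ** doubled_diag a
        = Omega ** (doubled_diag a ** Omega) ** doubled_diag a"
      by (simp add: matrix_mul_assoc)
    also have "\<dots> = (Omega ** Omega) ** doubled_diag a ** doubled_diag a"
      by (simp only: doubled_diag_Omega matrix_mul_assoc)
    finally have "Omega ** doubled_diag a ** Omega ** doubled_diag a
        = (Omega ** Omega) ** doubled_diag a ** doubled_diag a" .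
    then show ?thesis by (simp add: Omega_square matrix_mult_simps)
  qed
  have similar: "U ** Omega ** ?D' = Omega ** ?D ** U"
    unfolding eq[symmetric] by (simp add: matrix_mul_assoc symplectic_transpose[OF U])
  have "U ** Omega ** ?D' ** Omega ** ?D' = (Omega ** ?D ** U) ** Omega ** ?D'"
    by (simp only: similar)
  also have "\<dots> = Omega ** ?D ** (U ** Omega ** ?D')"
    by (simp only: matrix_mul_assoc)
  also have "\<dots> = Omega ** ?D ** (Omega ** ?D ** U)"
    by (simp only: similar)
  finally have "U ** (Omega ** ?D' ** Omega ** ?D') = (Omega ** ?D ** Omega ** ?D) ** U"
    by (simp add: matrix_mul_assoc)
  then have comm: "U ** ?D' ** ?D' = ?D ** ?D ** U"
    by (simp add: sq matrix_mult_simps matrix_mul_assoc)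
  have entries: "(doubled d i)\<^sup>2 * U $ i $ j = U $ i $ j * (doubled d' j)\<^sup>2" for i j
  proof -
    have "(?D ** (?D ** U)) $ i $ j = (U ** ?D' ** ?D') $ i $ j"
      by (simp add: comm matrix_mul_assoc)
    then show ?thesis
      unfolding doubled_diag_mult_entry by (simp add: power2_eq_square mult_ac)
  qed
  have "invertible U"
    using symplectic_inverse[OF U] by (metis invertible_def)
  then obtain \<pi> where \<pi>: "bij \<pi>" "\<And>i. U $ i $ \<pi> i \<noteq> 0"
    using det_nonzero_imp_transversal invertible_det_nz by blast
  have nonneg: "doubled d i \<ge> 0" "doubled d' i \<ge> 0" for i
    using pos by (auto simp: less_imp_le split: sum.split)
  have "doubled d i = doubled d' (\<pi> i)" for i
    using entries[of i "\<pi> i"] \<pi>(2)[of i] nonneg(1)[of i] nonneg(2)[of "\<pi> i"] by simp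
  then have "doubled d = doubled d' \<circ> \<pi>"
    by (simp add: fun_eq_iff)
  then have "image_mset (doubled d) (mset_set UNIV)
      = image_mset (doubled d') (image_mset \<pi> (mset_set UNIV))"
    by (simp add: multiset.map_comp)
  also have "image_mset \<pi> (mset_set UNIV) = mset_set UNIV"
    using \<pi>(1) by (simp add: bij_def image_mset_mset_set)
  finally have "image_mset (doubled d) (mset_set UNIV) = image_mset (doubled d') (mset_set UNIV)" .
  moreover have "image_mset (doubled a) (mset_set UNIV)
      = image_mset (($) a) (mset_set UNIV) + image_mset (($) a) (mset_set UNIV)" for a :: "real^'p"
  proof -
    have "mset_set (UNIV :: ('p + 'p) set)
        = image_mset Inl (mset_set UNIV) + image_mset Inr (mset_set UNIV)"
      unfolding UNIV_Plus_UNIV[symmetric] Plus_def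
      by (subst mset_set_Union) (auto simp: image_mset_mset_set)
    then show ?thesis
      by (simp add: multiset.map_comp o_def)
  qed
  ultimately show ?thesis
    by (simp add: multiset_eq_iff flip: mult_2)
qed

lemma symplectic_eigenvalues_eq:
  fixes N :: "('p::finite + 'p) sqmat"
  assumes d: "williamson_diagonal N d"
  shows "symplectic_eigenvalues N = image_mset (($) d) (mset_set UNIV)"
  unfolding symplectic_eigenvalues_def
proof (rule the_equality)
  show "\<exists>a. williamson_diagonal N a \<and>
      image_mset (($) d) (mset_set UNIV) = image_mset (($) a) (mset_set UNIV)"
    using d by blast
next
  fix E assume "\<exists>a. williamson_diagonal N a \<and> E = image_mset (($) a) (mset_set UNIV)"
  then obtain a where a: "williamson_diagonal N a" and E: "E = image_mset (($) a) (mset_set UNIV)"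
    by blast
  from a obtain T where T: "symplectic T" "transpose T ** N ** T = doubled_diag a"
    by (auto simp: williamson_diagonal_def)
  from d obtain S where S: "symplectic S" "transpose S ** N ** S = doubled_diag d"
    by (auto simp: williamson_diagonal_def)
  obtain T' where T': "symplectic T'" "T ** T' = mat 1" "T' ** T = mat 1"
    using symplectic_inverse[OF T(1)] .
  have "transpose (T' ** S) ** doubled_diag a ** (T' ** S)
      = transpose S ** transpose (T ** T') ** N ** (T ** T') ** S"
    by (simp add: T(2)[symmetric] matrix_transpose_mul matrix_mul_assoc)
  then have "transpose (T' ** S) ** doubled_diag a ** (T' ** S) = doubled_diag d"
    by (simp add: T' S)
  with symplectic_mult[OF T'(1) S(1)] show "E = image_mset (($) d) (mset_set UNIV)"
    unfolding E using a d
    by (intro symplectic_diagonal_unique) (auto simp: williamson_diagonal_def)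
qed

section \<open>The SSSP as surjectivity of a linear map\<close>

text \<open>
  Hamiltonian matrices are the tangent vectors at the identity to the symplectic group, that is, the
  kernel of the linearization of \<open>T\<^sup>T \<Omega> T = \<Omega>\<close>.
\<close>
lemma hamiltonian_iff: "H \<in> hamiltonian_matrices \<longleftrightarrow> transpose H ** Omega + Omega ** H = 0"
proof -
  have "transpose H ** Omega + Omega ** H = 0 \<longleftrightarrow> Omega ** H \<in> Symm"
    by (auto simp: Symm_def matrix_transpose_mul transpose_Omega matrix_mult_simps neg_eq_iff_add_eq_0)
  also have "\<dots> \<longleftrightarrow> (\<forall>i j. (Omega ** H) $ j $ i = (Omega ** H) $ i $ j)"
    by (simp add: Symm_def vec_eq_iff transpose_def)
  also have "\<dots> \<longleftrightarrow> H \<in> hamiltonian_matrices"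
  proof
    assume *: "\<forall>i j. (Omega ** H) $ j $ i = (Omega ** H) $ i $ j"
    define R E F where "R = (\<chi> k l. H $ Inl k $ Inl l)" and "E = (\<chi> k l. H $ Inl k $ Inr l)"
      and "F = (\<chi> k l. H $ Inr k $ Inl l)"
    have E: "H $ Inl k $ Inr l = H $ Inl l $ Inr k" and F: "H $ Inr k $ Inl l = H $ Inr l $ Inl k"
      and R: "H $ Inr k $ Inr l = - H $ Inl l $ Inl k" for k l
      using *[rule_format, of "Inr l" "Inr k"] *[rule_format, of "Inl l" "Inl k"]
        *[rule_format, of "Inl k" "Inr l"] by auto
    have "H $ i $ j = block_matrix R E F (- transpose R) $ i $ j" for i j
      by (cases i; cases j) (simp_all add: block_matrix_def R_def E_def F_def transpose_def R)
    then have "H = block_matrix R E F (- transpose R)"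
      by (simp add: vec_eq_iff)
    moreover have "E \<in> Symm" "F \<in> Symm"
      using E F by (auto simp: Symm_def E_def F_def transpose_def vec_eq_iff)
    ultimately show "H \<in> hamiltonian_matrices"
      unfolding hamiltonian_matrices_def by blast
  next
    assume "H \<in> hamiltonian_matrices"
    then obtain R E F where H: "H = block_matrix R E F (- transpose R)" and "E \<in> Symm" "F \<in> Symm"
      unfolding hamiltonian_matrices_def by blast
    then have "E $ k $ l = E $ l $ k" "F $ k $ l = F $ l $ k" for k l
      by (auto simp: Symm_def transpose_def vec_eq_iff)
    then have "(Omega ** H) $ j $ i = (Omega ** H) $ i $ j" for i j
      by (cases i; cases j) (auto simp: H block_matrix_def transpose_def)
    then show "\<forall>i j. (Omega ** H) $ j $ i = (Omega ** H) $ i $ j" by blast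
  qed
  finally show ?thesis by blast
qed

text \<open>
  The orthogonal projection onto the symmetric matrices that vanish at the non-edges of \<open>G\<close>; this
  subspace is the span of \<open>graph_matrices G\<close>. Parametrizing the span by a linear map defined on all
  matrices makes the condition in the SSSP a statement about the image of one linear map.
\<close>
definition pattern_projection :: "'v::finite set set \<Rightarrow> 'v sqmat \<Rightarrow> 'v sqmat" where
  "pattern_projection G X =
     (\<chi> i j. if i = j \<or> {i, j} \<in> G then (X $ i $ j + X $ j $ i) / 2 else 0)"

lemma linear_pattern_projection: "linear (pattern_projection G)"
  by (intro linearI) (auto simp: pattern_projection_def vec_eq_iff field_simps)

lemma pattern_projection_symmetric: "transpose (pattern_projection G X) = pattern_projection G X"
  by (auto simp: pattern_projection_def transpose_def vec_eq_iff insert_commute add.commute)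

text \<open>
  A matrix of the pattern may vanish at an edge and so fail to have graph \<open>G\<close>. It is the difference of
  two matrices that do: add a multiple of the adjacency matrix exceeding every entry, and subtract it.
\<close>
lemma pattern_projection_in_span: "pattern_projection G X \<in> span (graph_matrices G)"
proof -
  define B where "B = pattern_projection G X"
  define c where "c = norm B + 1"
  define E :: "'a sqmat" where "E = (\<chi> i j. if i \<noteq> j \<and> {i, j} \<in> G then c else 0)"
  have "c > 0" by (simp add: c_def add_nonneg_pos)
  have "E \<in> graph_matrices G"
    using \<open>c > 0\<close> by (auto simp: graph_matrices_def Symm_def E_def transpose_def vec_eq_iff insert_commute)
  moreover have "B + E \<in> graph_matrices G"
  proof -
    have "B $ i $ j + c \<noteq> 0" for i j
    proof -
      have "\<bar>B $ i $ j\<bar> \<le> norm B"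
        by (meson component_le_norm_cart Finite_Cartesian_Product.norm_nth_le order_trans)
      then show ?thesis unfolding c_def by linarith
    qed
    moreover have "transpose (B + E) = B + E"
      using \<open>E \<in> graph_matrices G\<close>
      by (simp add: transpose_simps B_def pattern_projection_symmetric graph_matrices_def Symm_def)
    ultimately show ?thesis
      by (auto simp: graph_matrices_def Symm_def E_def) (auto simp: B_def pattern_projection_def)
  qed
  ultimately have "(B + E) - E \<in> span (graph_matrices G)"
    by (intro span_diff span_base)
  then show ?thesis by (simp add: B_def)
qed

lemma pattern_projection_fixes_span:
  assumes "B \<in> span (graph_matrices G)"
  shows "pattern_projection G B = B"
proof -
  have "graph_matrices G \<subseteq> {A. pattern_projection G A = A}"
  proof
    fix A assume A: "A \<in> graph_matrices G"
    then have "A $ j $ i = A $ i $ j" for i j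
      by (auto simp: graph_matrices_def Symm_def transpose_def vec_eq_iff)
    with A show "A \<in> {A. pattern_projection G A = A}"
      by (auto simp: pattern_projection_def vec_eq_iff graph_matrices_def)
  qed
  moreover have "subspace {A. pattern_projection G A = A}"
    using linear_pattern_projection[of G]
    by (auto simp: subspace_def linear_0 linear_add linear_scale)
  ultimately show ?thesis
    using span_minimal assms by blast
qed

text \<open>
  The map on the right is the linearization of \<open>T\<^sup>T (N + \<Omega>) T\<close> at the identity, plus the pattern.
  Its symmetric part is the map in the definition of the SSSP. Its skew part
  \<open>H \<mapsto> H\<^sup>T \<Omega> + \<Omega> H\<close> is onto the skew matrices with the Hamiltonian matrices as kernel. So a target
  is reached by first hitting its skew part and then correcting the symmetric part with a Hamiltonian
  matrix; conversely, a symmetric target is only reached with a Hamiltonian \<open>H\<close>.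
\<close>
lemma SSSP_iff_surjective:
  fixes N :: "('p::finite + 'p) sqmat"
  assumes N: "pos_def N"
  shows "SSSP N \<longleftrightarrow> (\<forall>Y. \<exists>H X. transpose H ** (N + Omega) + (N + Omega) ** H
            + pattern_projection (labeled_graph N) X = Y)"
    (is "_ \<longleftrightarrow> (\<forall>Y. \<exists>H X. _ + ?P X = Y)")
proof -
  have NS: "transpose N = N"
    using N by (simp add: pos_def_def Symm_def)
  have symm: "transpose (N ** H + transpose H ** N + ?P X) = N ** H + transpose H ** N + ?P X" for H X
    by (simp add: transpose_simps matrix_transpose_mul NS pattern_projection_symmetric add.commute)
  have skew: "transpose (transpose H ** Omega + Omega ** H) = - (transpose H ** Omega + Omega ** H)"
    for H :: "('p + 'p) sqmat"
    by (simp add: transpose_simps matrix_transpose_mul transpose_Omega matrix_mult_simps)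
  have split: "transpose H ** (N + Omega) + (N + Omega) ** H + ?P X
      = (N ** H + transpose H ** N + ?P X) + (transpose H ** Omega + Omega ** H)" for H X
    by (simp add: matrix_mult_simps)
  show ?thesis
  proof
    assume S: "SSSP N"
    show "\<forall>Y. \<exists>H X. transpose H ** (N + Omega) + (N + Omega) ** H + ?P X = Y"
    proof
      fix Y :: "('p + 'p) sqmat"
      define K where "K = (1/2) *\<^sub>R (Y - transpose Y)"
      \<comment> \<open>Half of \<open>- \<Omega> K\<close>, so that \<open>H\<^sup>T \<Omega>\<close> and \<open>\<Omega> H\<close> each contribute one half of \<open>K\<close>.\<close>
      define H0 where "H0 = - ((1/2) *\<^sub>R (Omega ** K))"
      have Kskew: "transpose K = - K"
        by (simp add: K_def transpose_simps algebra_simps)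
      have "transpose H0 = - ((1/2) *\<^sub>R (K ** Omega))"
        by (simp add: H0_def transpose_simps matrix_transpose_mul Kskew transpose_Omega matrix_mult_simps)
      then have "transpose H0 ** Omega = (1/2) *\<^sub>R K"
        by (simp add: matrix_mult_simps matrix_mult_scaleR Omega_square flip: matrix_mul_assoc)
      moreover have "Omega ** H0 = (1/2) *\<^sub>R K"
        by (simp add: H0_def matrix_mult_simps matrix_mult_scaleR Omega_square matrix_mul_assoc)
      ultimately have H0: "transpose H0 ** Omega + Omega ** H0 = K"
        by (simp flip: scaleR_add_left)
      define Y' where "Y' = Y - K - (N ** H0 + transpose H0 ** N)"
      have "Y' \<in> Symm"
        by (simp add: Y'_def Symm_def transpose_simps matrix_transpose_mul NS Kskew)
           (simp add: K_def vec_eq_iff transpose_def field_simps)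
      with S obtain M B where M: "M \<in> hamiltonian_matrices"
        and B: "B \<in> span (graph_matrices (labeled_graph N))"
        and Y': "Y' = (N ** M + transpose M ** N) + B"
        unfolding SSSP_def by blast
      have "transpose (H0 + M) ** (N + Omega) + (N + Omega) ** (H0 + M) + ?P B
          = (N ** M + transpose M ** N + B) + (N ** H0 + transpose H0 ** N)
            + (transpose H0 ** Omega + Omega ** H0) + (transpose M ** Omega + Omega ** M)"
        by (simp add: transpose_simps matrix_mult_simps pattern_projection_fixes_span[OF B])
      also have "\<dots> = Y"
        using M by (simp add: H0 hamiltonian_iff Y'[symmetric] Y'_def)
      finally show "\<exists>H X. transpose H ** (N + Omega) + (N + Omega) ** H + ?P X = Y"
        by blast
    qed
  next
    assume surj: "\<forall>Y. \<exists>H X. transpose H ** (N + Omega) + (N + Omega) ** H + ?P X = Y"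
    have "N ** M + transpose M ** N + B \<in> Symm" if "B \<in> span (graph_matrices (labeled_graph N))" for M B
      using symm[of M B] by (simp add: Symm_def pattern_projection_fixes_span[OF that])
    moreover have "\<exists>M B. Y = (N ** M + transpose M ** N) + B \<and> M \<in> hamiltonian_matrices \<and>
        B \<in> span (graph_matrices (labeled_graph N))" if "Y \<in> Symm" for Y
    proof -
      from surj obtain H X where "transpose H ** (N + Omega) + (N + Omega) ** H + ?P X = Y"
        by blast
      then have eq: "(N ** H + transpose H ** N + ?P X) + (transpose H ** Omega + Omega ** H) = Y + 0"
        by (simp add: split)
      have "transpose Y = Y" "transpose 0 = - (0 :: ('p + 'p) sqmat)"
        using that linear_0[OF linear_transpose] by (simp_all add: Symm_def)
      then have "N ** H + transpose H ** N + ?P X = Y" "H \<in> hamiltonian_matrices"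
        using symmetric_plus_skew_unique[OF eq symm _ skew] by (auto simp: hamiltonian_iff)
      then show ?thesis
        using pattern_projection_in_span by blast
    qed
    ultimately show "SSSP N"
      unfolding SSSP_def using N by blast
  qed
qed

text \<open>
  A linear section \<open>Z \<mapsto> (L Z, Q Z)\<close> of the linearization, with \<open>Q Z\<close> already in the pattern. The bound
  \<open>C\<close> enters the radii of all later neighbourhoods of \<open>N\<close>.
\<close>
lemma SSSP_right_inverse:
  fixes N :: "('p::finite + 'p) sqmat"
  assumes "SSSP N"
  obtains L Q C where "linear L" "linear Q" "C > 0"
    "\<And>Z. norm (L Z) \<le> C * norm Z" "\<And>Z. norm (Q Z) \<le> C * norm Z"
    "\<And>Z. transpose (L Z) ** (N + Omega) + (N + Omega) ** L Z + Q Z = Z"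
    "\<And>Z. pattern_projection (labeled_graph N) (Q Z) = Q Z"
proof -
  let ?P = "pattern_projection (labeled_graph N)"
  define \<Phi> where "\<Phi> = (\<lambda>(H, X). transpose H ** (N + Omega) + (N + Omega) ** H + ?P X)"
  have "linear \<Phi>"
    by (intro linearI)
       (auto simp: \<Phi>_def transpose_simps matrix_mult_simps linear_add[OF linear_pattern_projection]
         linear_scale[OF linear_pattern_projection] matrix_mult_scaleR algebra_simps)
  moreover have "surj \<Phi>"
    unfolding surj_def
  proof
    fix Y
    have "pos_def N" using assms by (simp add: SSSP_def)
    then obtain H X where "\<Phi> (H, X) = Y"
      using assms SSSP_iff_surjective[of N] unfolding \<Phi>_def by auto blast
    then show "\<exists>p. Y = \<Phi> p" by blast
  qed
  ultimately obtain g where g: "linear g" "\<Phi> \<circ> g = id"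
    using linear_surjective_right_inverse by blast
  define L where "L = fst \<circ> g"
  define Q where "Q = ?P \<circ> (snd \<circ> g)"
  have lin: "linear L" "linear Q"
    unfolding L_def Q_def
    by (intro linear_compose g linear_fst linear_snd linear_pattern_projection)+
  obtain C1 where C1: "C1 > 0" "\<And>Z. norm (L Z) \<le> C1 * norm Z"
    using linear_bounded_pos[OF lin(1)] by blast
  obtain C2 where C2: "C2 > 0" "\<And>Z. norm (Q Z) \<le> C2 * norm Z"
    using linear_bounded_pos[OF lin(2)] by blast
  show thesis
  proof
    show "linear L" "linear Q" by (fact lin)+
    show "max C1 C2 > 0" using C1 by simp
    show "norm (L Z) \<le> max C1 C2 * norm Z" for Z
      by (rule order_trans[OF C1(2)]) (simp add: mult_right_mono)
    show "norm (Q Z) \<le> max C1 C2 * norm Z" for Z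
      by (rule order_trans[OF C2(2)]) (simp add: mult_right_mono)
    show "transpose (L Z) ** (N + Omega) + (N + Omega) ** L Z + Q Z = Z" for Z
      using fun_cong[OF g(2), of Z] by (simp add: \<Phi>_def L_def Q_def split_beta)
    show "?P (Q Z) = Q Z" for Z
      by (simp add: Q_def pattern_projection_fixes_span pattern_projection_in_span)
  qed
qed

section \<open>Stability of the SSSP and return to the pattern\<close>

text \<open>
  Composed with the section of the linearization at \<open>N\<close>, the linearization at a nearby \<open>N'\<close> is the identity plus
  a map of norm less than one. It is injective, hence surjective. The graph must be the same so that
  the two linearizations use the same pattern.
\<close>
lemma SSSP_open:
  fixes N :: "('p::finite + 'p) sqmat"
  assumes "SSSP N"
  obtains \<eta> where "\<eta> > 0"
    "\<And>N'. pos_def N' \<Longrightarrow> labeled_graph N' = labeled_graph N \<Longrightarrow> norm (N' - N) < \<eta> \<Longrightarrow> SSSP N'"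
proof -
  obtain L Q C where lin: "linear L" "linear Q"
    and C: "C > 0" "\<And>Z. norm (L Z) \<le> C * norm Z" "\<And>Z. norm (Q Z) \<le> C * norm Z"
    and inv: "\<And>Z. transpose (L Z) ** (N + Omega) + (N + Omega) ** L Z + Q Z = Z"
    and Q: "\<And>Z. pattern_projection (labeled_graph N) (Q Z) = Q Z"
    by (rule SSSP_right_inverse[OF assms]) (rule that)
  show thesis
  proof
    show "1 / (2 * C) > 0" using C by simp
    fix N' :: "('p + 'p) sqmat"
    assume N': "pos_def N'" "labeled_graph N' = labeled_graph N" "norm (N' - N) < 1 / (2 * C)"
    define \<Delta> where "\<Delta> = N' - N"
    define \<Psi> where "\<Psi> Z = transpose (L Z) ** (N' + Omega) + (N' + Omega) ** L Z + Q Z" for Z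
    have \<Psi>: "\<Psi> Z = Z + (transpose (L Z) ** \<Delta> + \<Delta> ** L Z)" for Z
      by (subst (2) inv[of Z, symmetric]) (simp add: \<Psi>_def \<Delta>_def matrix_mult_simps)
    have "linear \<Psi>"
      by (intro linearI)
         (auto simp: \<Psi>_def transpose_simps matrix_mult_simps linear_add[OF lin(1)] linear_add[OF lin(2)]
           linear_scale[OF lin(1)] linear_scale[OF lin(2)] matrix_mult_scaleR
           algebra_simps)
    moreover have "inj \<Psi>"
      unfolding linear_injective_0[OF \<open>linear \<Psi>\<close>]
    proof (intro allI impI)
      fix Z assume "\<Psi> Z = 0"
      then have "norm Z = norm (transpose (L Z) ** \<Delta> + \<Delta> ** L Z)"
        by (metis \<Psi> add_eq_0_iff norm_minus_cancel)
      also have "\<dots> \<le> norm (L Z) * norm \<Delta> + norm \<Delta> * norm (L Z)"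
        by (rule norm_triangle_le) (metis add_mono norm_matrix_mult_le norm_transpose)
      also have "\<dots> \<le> 2 * C * norm \<Delta> * norm Z"
        using mult_right_mono[OF C(2)[of Z], of "norm \<Delta>"] by (simp add: mult_ac)
      finally have "norm Z * (1 - 2 * C * norm \<Delta>) \<le> 0"
        by (simp add: algebra_simps)
      moreover have "2 * C * norm \<Delta> < 1"
        using N'(3) C(1) by (simp add: \<Delta>_def field_simps)
      ultimately show "Z = 0"
        by (simp add: mult_le_0_iff)
    qed
    ultimately have "surj \<Psi>"
      by (simp add: linear_injective_imp_surjective)
    then show "SSSP N'"
      unfolding SSSP_iff_surjective[OF N'(1)] N'(2) \<Psi>_def surj_def using Q by metis
  qed
qed

lemma labeled_graph_stable:
  fixes N :: "'v::finite sqmat"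
  obtains \<eta> where "\<eta> > 0"
    "\<And>N'. norm (N' - N) < \<eta> \<Longrightarrow> \<forall>i j. i \<noteq> j \<longrightarrow> N $ i $ j = 0 \<longrightarrow> N' $ i $ j = 0 \<Longrightarrow>
      labeled_graph N' = labeled_graph N"
proof
  define \<eta> where "\<eta> = Min (insert 1 {\<bar>N $ i $ j\<bar> | i j. N $ i $ j \<noteq> 0})"
  have fin: "finite {\<bar>N $ i $ j\<bar> | i j. N $ i $ j \<noteq> 0}"
    by (rule finite_subset[of _ "(\<lambda>(i, j). \<bar>N $ i $ j\<bar>) ` UNIV"]) auto
  show "\<eta> > 0"
    unfolding \<eta>_def using fin by (subst Min_gr_iff) auto
  fix N' :: "'v sqmat"
  assume close: "norm (N' - N) < \<eta>" 
    and zero: "\<forall>i j. i \<noteq> j \<longrightarrow> N $ i $ j = 0 \<longrightarrow> N' $ i $ j = 0"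
  have "N' $ i $ j \<noteq> 0" if "N $ i $ j \<noteq> 0" for i j
  proof -
    have "\<eta> \<le> \<bar>N $ i $ j\<bar>"
      unfolding \<eta>_def using fin that by (intro Min_le) auto
    moreover have "\<bar>(N' - N) $ i $ j\<bar> \<le> norm (N' - N)"
      by (meson component_le_norm_cart Finite_Cartesian_Product.norm_nth_le order_trans)
    ultimately show ?thesis
      using close by auto
  qed
  then have "i \<noteq> j \<Longrightarrow> N' $ i $ j \<noteq> 0 \<longleftrightarrow> N $ i $ j \<noteq> 0" for i j
    using zero by blast
  then show "labeled_graph N' = labeled_graph N"
    unfolding labeled_graph_def by blast
qed

text \<open>
  With \<open>A = N + \<Omega>\<close>, \<open>\<Delta> = N'' - N\<close> and \<open>T = 1 + L Z\<close>, the equation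
  \<open>T\<^sup>T (A + \<Delta>) T = A - Q Z\<close> reads \<open>Z = h Z\<close>, where \<open>- h Z\<close> is the sum of the perturbation \<open>T\<^sup>T \<Delta> T\<close> and the
  quadratic term \<open>(L Z)\<^sup>T A (L Z)\<close>, since the terms that are linear in \<open>Z\<close> add up to \<open>Z\<close> by the choice of
  \<open>L\<close> and \<open>Q\<close>. On a small ball the quadratic term is at most half the radius, and for \<open>N''\<close> close to \<open>N\<close>
  so is the perturbation; Brouwer's theorem gives a fixed point without any Lipschitz estimate.
\<close>
lemma symplectic_congruence_into_pattern:
  fixes N :: "('p::finite + 'p) sqmat"
  assumes "SSSP N" "\<rho> > 0"
  obtains \<epsilon> where "\<epsilon> > 0"
    "\<And>N''. N'' \<in> Symm \<Longrightarrow> norm (N'' - N) < \<epsilon> \<Longrightarrow>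
      \<exists>T. symplectic T \<and> norm (transpose T ** N'' ** T - N) < \<rho> \<and>
        pattern_projection (labeled_graph N) (transpose T ** N'' ** T - N) = transpose T ** N'' ** T - N"
proof -
  let ?P = "pattern_projection (labeled_graph N)"
  obtain L Q C where lin: "linear L" "linear Q"
    and C: "C > 0" "\<And>Z. norm (L Z) \<le> C * norm Z" "\<And>Z. norm (Q Z) \<le> C * norm Z"
    and inv: "\<And>Z. transpose (L Z) ** (N + Omega) + (N + Omega) ** L Z + Q Z = Z"
    and Q: "\<And>Z. ?P (Q Z) = Q Z"
    by (rule SSSP_right_inverse[OF assms(1)]) (rule that)
  have NS: "transpose N = N"
    using assms(1) by (simp add: SSSP_def pos_def_def Symm_def)
  define A where "A = N + Omega"
  define k where "k = norm (mat 1 :: ('p + 'p) sqmat) + 1"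
  have "k > 0" by (simp add: k_def add_nonneg_pos)
  \<comment> \<open>The three bounds give \<open>|T| \<le> k\<close>, control of the quadratic term, and closeness to \<open>N\<close>.\<close>
  define r where "r = Min {1 / C, 1 / (2 * C\<^sup>2 * (norm A + 1)), \<rho> / (2 * C)}"
  have A1: "norm A + 1 > 0" by (simp add: add_nonneg_pos)
  have "r > 0" using C(1) A1 assms(2) by (simp add: r_def)
  have r1: "C * r \<le> 1"
  proof -
    have "r \<le> 1 / C" by (simp add: r_def)
    then show ?thesis using C(1) by (simp add: field_simps)
  qed
  have r2: "C\<^sup>2 * r * norm A \<le> 1 / 2"
  proof -
    have "r \<le> 1 / (2 * C\<^sup>2 * (norm A + 1))" by (simp add: r_def)
    then have "r * (2 * C\<^sup>2 * (norm A + 1)) \<le> 1"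
      using C(1) A1 by (subst (asm) pos_le_divide_eq) auto
    moreover have "0 \<le> r * (2 * C\<^sup>2)" using \<open>r > 0\<close> by simp
    ultimately show ?thesis by (simp add: algebra_simps)
  qed
  have r3: "C * r < \<rho>"
  proof -
    have "r \<le> \<rho> / (2 * C)" by (simp add: r_def)
    then have "2 * (C * r) \<le> \<rho>" using C(1) by (simp add: field_simps)
    then show ?thesis using C(1) \<open>r > 0\<close> by (smt (verit) mult_pos_pos)
  qed
  show thesis
  proof
    show "r / (2 * k\<^sup>2) > 0" using \<open>r > 0\<close> \<open>k > 0\<close> by simp
    fix N'' :: "('p + 'p) sqmat"
    assume N'': "N'' \<in> Symm" "norm (N'' - N) < r / (2 * k\<^sup>2)"
    define \<Delta> where "\<Delta> = N'' - N"
    define T where "T Z = mat 1 + L Z" for Z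
    define h where "h Z = - (transpose (T Z) ** \<Delta> ** T Z + transpose (L Z) ** A ** L Z)" for Z
    have "\<exists>Z\<in>cball 0 r. h Z = Z"
    proof (rule brouwer)
      have "continuous_on (cball 0 r) L" "continuous_on (cball 0 r) (\<lambda>Z. transpose (L Z))"
        using linear_continuous_on linear_conv_bounded_linear lin(1)
          linear_compose[OF lin(1) linear_transpose] by (auto simp: o_def)
      then show "continuous_on (cball 0 r) h"
        unfolding h_def T_def transpose_simps
        by (intro continuous_intros bounded_bilinear.continuous_on[OF bounded_bilinear_matrix_mult])
    next
      show "h \<in> cball 0 r \<rightarrow> cball 0 r"
      proof
        fix Z assume "Z \<in> cball (0 :: ('p + 'p) sqmat) r"
        then have "norm Z \<le> r" by simp
        then have LZ: "norm (L Z) \<le> C * r"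
          using C(1) C(2)[of Z] by (meson mult_left_mono less_imp_le order_trans)
        have TZ: "norm (T Z) \<le> k"
          unfolding T_def k_def by (rule norm_triangle_le) (use LZ r1 in simp)
        have "norm (transpose (T Z) ** \<Delta> ** T Z) \<le> norm (T Z) * norm \<Delta> * norm (T Z)"
          by (rule norm_congruence_le)
        also have "\<dots> \<le> k * (r / (2 * k\<^sup>2)) * k"
          using N''(2) TZ \<open>k > 0\<close> \<open>r > 0\<close> by (intro mult_mono) (auto simp: \<Delta>_def)
        also have "\<dots> = r / 2"
          using \<open>k > 0\<close> by (simp add: power2_eq_square)
        finally have 1: "norm (transpose (T Z) ** \<Delta> ** T Z) \<le> r / 2" .
        have "norm (transpose (L Z) ** A ** L Z) \<le> norm (L Z) * norm A * norm (L Z)"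
          by (rule norm_congruence_le)
        also have "\<dots> \<le> (C * r) * norm A * (C * r)"
          using LZ C(1) \<open>r > 0\<close> by (intro mult_mono) auto
        also have "\<dots> = (C\<^sup>2 * r * norm A) * r"
          by (simp add: power2_eq_square)
        also have "\<dots> \<le> 1 / 2 * r"
          using \<open>r > 0\<close> r2 by (intro mult_right_mono) auto
        finally have 2: "norm (transpose (L Z) ** A ** L Z) \<le> r / 2" by simp
        have "norm (h Z) \<le> r"
          unfolding h_def norm_minus_cancel by (rule norm_triangle_le) (use 1 2 in simp)
        then show "h Z \<in> cball 0 r" by simp
      qed
    qed (use \<open>r > 0\<close> in auto)
    then obtain Z where "norm Z \<le> r" and fixpoint: "h Z = Z" by auto
    have "norm (- Q Z) < \<rho>"
    proof -
      have "norm (Q Z) \<le> C * r"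
        using C(1) C(3)[of Z] \<open>norm Z \<le> r\<close> by (meson mult_left_mono less_imp_le order_trans)
      then show ?thesis using r3 by simp
    qed
    have "transpose (T Z) ** (A + \<Delta>) ** T Z = A - Q Z + (Z - h Z)"
      by (subst inv[of Z, symmetric])
         (simp add: h_def T_def A_def transpose_simps matrix_mult_simps algebra_simps)
    then have eq: "transpose (T Z) ** N'' ** T Z + transpose (T Z) ** Omega ** T Z = (N - Q Z) + Omega"
      by (simp add: fixpoint A_def \<Delta>_def matrix_mult_simps algebra_simps)
    have sym: "transpose (transpose (T Z) ** N'' ** T Z) = transpose (T Z) ** N'' ** T Z"
      using N''(1) by (simp add: Symm_def matrix_transpose_mul matrix_mul_assoc)
    have "transpose (Q Z) = Q Z"
      using pattern_projection_symmetric[of "labeled_graph N" "Q Z"] by (simp add: Q)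
    then have sym': "transpose (N - Q Z) = N - Q Z"
      by (simp add: transpose_simps NS)
    have skew: "transpose (transpose (T Z) ** Omega ** T Z) = - (transpose (T Z) ** Omega ** T Z)"
      by (simp add: matrix_transpose_mul transpose_Omega matrix_mult_simps matrix_mul_assoc)
    \<comment> \<open>The symmetric and the skew part of the equation.\<close>
    have "transpose (T Z) ** N'' ** T Z - N = - Q Z" and "symplectic (T Z)"
      using symmetric_plus_skew_unique[OF eq sym sym' skew transpose_Omega]
      by (simp_all add: symplectic_def)
    moreover have "?P (- Q Z) = - Q Z"
      by (simp add: linear_neg[OF linear_pattern_projection] Q)
    ultimately show "\<exists>T. symplectic T \<and> norm (transpose T ** N'' ** T - N) < \<rho> \<and>
        ?P (transpose T ** N'' ** T - N) = transpose T ** N'' ** T - N"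
      using \<open>norm (- Q Z) < \<rho>\<close> by (intro exI[of _ "T Z"]) simp
  qed
qed

section \<open>Refining a multiplicity list by a small perturbation\<close>

definition multiplicity_list :: "real multiset \<Rightarrow> nat list" where
  "multiplicity_list E = map (count E) (sorted_list_of_set (set_mset E))"

text \<open>
  The sorted list of the eigenvalues is \<open>runs\<close> of the multiplicities and the distinct values. The second
  argument may also contain repeated values, in which case the blocks of an equal value merge; this
  is how a refinement is described before its values are separated.
\<close>
definition runs :: "nat list \<Rightarrow> real list \<Rightarrow> real list" where
  "runs ks ws = concat (map2 replicate ks ws)"

lemma runs_Nil [simp]: "runs [] ws = []" "runs ks [] = []"
  and runs_Cons [simp]: "runs (k # ks) (w # ws) = replicate k w @ runs ks ws"
  by (simp_all add: runs_def)

lemma runs_append: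
  "length ks = length ws \<Longrightarrow> runs (ks @ ks') (ws @ ws') = runs ks ws @ runs ks' ws'"
  by (simp add: runs_def)

lemma runs_replicate: "runs ks (replicate (length ks) w) = replicate (sum_list ks) w"
  by (induction ks) (simp_all add: replicate_add)

lemma set_runs_subset: "set (runs ks ws) \<subseteq> set ws"
  by (auto simp: runs_def dest: set_zip_rightD)

lemma set_runs:
  assumes "length ks = length ws" "\<forall>k\<in>set ks. k > 0"
  shows "set (runs ks ws) = set ws"
  using assms by (induction ks ws rule: list_induct2) auto

lemma map_count_runs:
  assumes "length ks = length ws" "distinct ws"
  shows "map (count (mset (runs ks ws))) ws = ks"
  using assms
proof (induction ks ws rule: list_induct2)
  case (Cons k ks w ws)
  have "count (mset (runs ks ws)) w = 0"
    using Cons.prems set_runs_subset by (fastforce simp: count_eq_zero_iff)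
  then have "count (mset (runs (k # ks) (w # ws))) w = k"
    by simp
  moreover have "map (count (mset (runs (k # ks) (w # ws)))) ws = map (count (mset (runs ks ws))) ws"
    using Cons.prems by (intro map_cong) auto
  moreover have "map (count (mset (runs ks ws))) ws = ks"
    using Cons by simp
  ultimately show ?case
    by (simp del: runs_Cons)
qed simp

lemma multiplicity_list_runs:
  assumes "length ks = length ws" "\<forall>k\<in>set ks. k > 0" "sorted_wrt (<) ws"
  shows "multiplicity_list (mset (runs ks ws)) = ks"
proof -
  have "sorted_list_of_set (set ws) = ws"
    using assms(3) by (simp add: strict_sorted_iff sorted_list_of_set.idem_if_sorted_distinct)
  then show ?thesis
    using assms by (simp add: multiplicity_list_def set_runs map_count_runs strict_sorted_iff)
qed

lemma sorted_runs:
  assumes "sorted ws"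
  shows "sorted (runs ks ws)"
  using assms
proof (induction ws arbitrary: ks)
  case (Cons w ws)
  then show ?case
    using set_runs_subset by (cases ks) (fastforce simp: sorted_append)+
qed simp

lemma mset_runs_multiplicity_list:
  "mset (runs (multiplicity_list E) (sorted_list_of_set (set_mset E))) = E"
proof (rule multiset_eqI)
  fix x
  define vs where "vs = sorted_list_of_set (set_mset E)"
  have vs: "distinct vs" "set vs = set_mset E"
    by (simp_all add: vs_def)
  let ?R = "runs (map (count E) vs) vs"
  have "map (count (mset ?R)) vs = map (count E) vs"
    using vs by (intro map_count_runs) auto
  then have "count (mset ?R) x = count E x" if "x \<in># E"
    using that vs by simp
  moreover have "count (mset ?R) x = count E x" if "x \<notin># E"
    using that vs set_runs_subset[of "map (count E) vs" vs]
    by (metis count_mset_0_iff not_in_iff subsetD)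
  ultimately show "count (mset (runs (multiplicity_list E) (sorted_list_of_set (set_mset E)))) x
      = count E x"
    unfolding multiplicity_list_def vs_def by blast
qed

text \<open>
  Repeating each value once for every part of its multiplicity describes the same list of eigenvalues
  by the refined block lengths.
\<close>
lemma runs_refine:
  assumes "length parts = length vs" "sorted vs"
  obtains ws where "length ws = length (concat parts)" "sorted ws"
    "runs (concat parts) ws = runs (map sum_list parts) vs" "set ws \<subseteq> set vs"
  using assms
proof (induction parts vs arbitrary: thesis rule: list_induct2)
  case Nil
  then show ?case by simp
next
  case (Cons ks parts v vs)
  obtain ws where ws: "length ws = length (concat parts)" "sorted ws"
    "runs (concat parts) ws = runs (map sum_list parts) vs" "set ws \<subseteq> set vs"
    using Cons by auto
  show ?case
    by (rule Cons.prems(1)[of "replicate (length ks) v @ ws"])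
       (use ws Cons.prems(2) in \<open>auto simp: runs_append runs_replicate sorted_append\<close>)
qed

lemma list_all2_replicate: "P x y \<Longrightarrow> list_all2 P (replicate n x) (replicate n y)"
  by (induction n) auto

lemma list_all2_runs:
  assumes "list_all2 P ws ws'"
  shows "list_all2 P (runs ks ws) (runs ks ws')"
  using assms
proof (induction arbitrary: ks rule: list_all2_induct)
  case (Cons w ws w' ws')
  then show ?case
    by (cases ks) (auto intro!: list_all2_appendI simp: list_all2_replicate)
qed simp

text \<open>
  Adding a small multiple of the position keeps the order and separates equal neighbours, whatever the
  gaps between the distinct values are.
\<close>
lemma strictly_increasing_perturbation:
  fixes ws :: "real list"
  assumes "sorted ws" "\<epsilon> > 0"
  obtains ws' where "sorted_wrt (<) ws'" "list_all2 (\<lambda>w w'. w \<le> w' \<and> w' < w + \<epsilon>) ws ws'"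
proof -
  define \<delta> where "\<delta> = \<epsilon> / (real (length ws) + 1)"
  have "\<delta> > 0" using assms(2) by (simp add: \<delta>_def)
  define ws' where "ws' = map (\<lambda>j. ws ! j + \<delta> * real j) [0..<length ws]"
  have "sorted_wrt (<) ws'"
    using assms(1) \<open>\<delta> > 0\<close>
    by (auto simp: ws'_def sorted_wrt_iff_nth_less sorted_iff_nth_mono intro!: add_le_less_mono)
  moreover have "\<delta> * real j < \<epsilon>" if "j < length ws" for j
  proof -
    have "\<delta> * real j < \<delta> * (real (length ws) + 1)"
      using that \<open>\<delta> > 0\<close> by (intro mult_strict_left_mono) auto
    then show ?thesis by (simp add: \<delta>_def)
  qed
  ultimately show thesis
    using that[of ws'] \<open>\<delta> > 0\<close> by (auto simp: ws'_def list_all2_conv_all_nth)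
qed

text \<open>
  The sorted diagonal of \<open>d\<close> is cut into blocks according to \<open>ms\<close>; within a block all values are equal, and
  raising the block values by small, strictly increasing amounts separates the blocks. The values are
  never lowered, so positivity of the diagonal is preserved.
\<close>
lemma refine_multiplicities:
  fixes d :: "real^'p::finite"
  assumes ref: "refinement ms (multiplicity_list (image_mset (($) d) (mset_set UNIV)))"
    and "\<epsilon> > 0"
  obtains d' :: "real^'p" where "\<And>i. d $ i \<le> d' $ i" "\<And>i. d' $ i < d $ i + \<epsilon>"
    "multiplicity_list (image_mset (($) d') (mset_set UNIV)) = ms"
proof -
  define E where "E = image_mset (($) d) (mset_set UNIV)"
  define vs where "vs = sorted_list_of_set (set_mset E)"
  obtain parts where ms: "ms = concat parts" and parts: "map sum_list parts = multiplicity_list E"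
    and pos: "\<forall>k\<in>set ms. k > 0"
    using ref by (auto simp: refinement_def E_def)
  have "length parts = length vs"
    using parts by (metis length_map multiplicity_list_def vs_def)
  then obtain ws where ws: "length ws = length ms" "sorted ws" "runs ms ws = runs (multiplicity_list E) vs"
    using runs_refine[of parts vs] unfolding ms parts[symmetric] by (auto simp: vs_def)
  obtain ws' where ws': "sorted_wrt (<) ws'" "list_all2 (\<lambda>w w'. w \<le> w' \<and> w' < w + \<epsilon>) ws ws'"
    using strictly_increasing_perturbation[OF ws(2) \<open>\<epsilon> > 0\<close>] .
  obtain us0 :: "'p list" where us0: "set us0 = UNIV" "distinct us0"
    using finite_distinct_list[OF finite] by blast
  \<comment> \<open>An enumeration of the indices along which \<open>d\<close> is sorted links lists of values to vectors.\<close>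
  define us where "us = sort_key (($) d) us0"
  have us: "distinct us" "set us = UNIV" and us_mset: "mset us = mset_set UNIV"
    using us0 mset_set_set[of us0] by (simp_all add: us_def)
  have runs_d: "runs ms ws = map (($) d) us"
  proof -
    have "mset (runs ms ws) = mset (map (($) d) us)"
      using mset_runs_multiplicity_list[of E] by (simp add: ws(3) us_mset vs_def) (simp add: E_def)
    moreover have "sorted (map (($) d) us)"
      by (simp add: us_def)
    ultimately show ?thesis
      using sorted_runs[OF ws(2)] by (metis properties_for_sort)
  qed
  define f where "f = the \<circ> map_of (zip us (runs ms ws'))"
  have close: "list_all2 (\<lambda>w w'. w \<le> w' \<and> w' < w + \<epsilon>) (map (($) d) us) (runs ms ws')"
    using list_all2_runs[OF ws'(2), of ms] by (simp add: runs_d)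
  then have len: "length us = length (runs ms ws')"
    by (auto dest: list_all2_lengthD)
  then have f: "map f us = runs ms ws'"
    using us(1) by (simp add: list_eq_iff_nth_eq f_def map_of_zip_nth)
  have "d $ i \<le> f i \<and> f i < d $ i + \<epsilon>" for i
  proof -
    have "i \<in> set us" using us by simp
    then show ?thesis
      using close unfolding f[symmetric] by (auto simp: list_all2_conv_all_nth in_set_conv_nth)
  qed
  moreover have "multiplicity_list (image_mset (($) (\<chi> i. f i)) (mset_set UNIV)) = ms"
  proof -
    have "(($) (\<chi> i. f i)) = f"
      by (rule ext) simp
    then have "image_mset (($) (\<chi> i. f i)) (mset_set UNIV) = mset (map f us)"
      by (simp add: us_mset)
    then show ?thesis
      unfolding f using multiplicity_list_runs[OF _ pos ws'(1)] ws(1) ws'(2)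
      by (simp add: list_all2_lengthD)
  qed
  ultimately show thesis
    using that[of "\<chi> i. f i"] by simp
qed

section \<open>Realizing refinements with the same graph\<close>

lemma pos_def_doubled_diag:
  assumes "\<And>i. d $ i > 0"
  shows "pos_def (doubled_diag d)"
proof -
  have "x \<bullet> (doubled_diag d *v x) > 0" if "x \<noteq> 0" for x
  proof -
    from that obtain k where "x $ k \<noteq> 0"
      unfolding vec_eq_iff by auto
    have pos: "doubled d i > 0" for i
      using assms by (cases i) auto
    have "x \<bullet> (doubled_diag d *v x) = (\<Sum>i\<in>UNIV. doubled d i * (x $ i)\<^sup>2)"
      by (simp add: inner_vec_def matrix_vector_mult_def doubled_diag_entry power2_eq_square mult_ac
          if_distrib[of "\<lambda>x. x * _"] if_distrib[of "\<lambda>x. _ * x"] cong: if_cong)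
    also have "\<dots> > 0"
      using pos \<open>x $ k \<noteq> 0\<close>
      by (intro sum_pos2[of _ k]) (auto simp: less_imp_le)
    finally show ?thesis .
  qed
  moreover have "transpose (doubled_diag d) = doubled_diag d"
    by (simp add: vec_eq_iff transpose_def doubled_diag_entry)
  ultimately show ?thesis
    by (simp add: pos_def_def Symm_def)
qed

text \<open>
  The perturbed matrix \<open>F d'\<close> depends linearly on \<open>d'\<close>, so it is close to \<open>N = F d\<close>. Correcting it by a
  symplectic congruence into the pattern keeps its Williamson form \<open>D' \<oplus> D'\<close>, and the corrected matrix
  is close enough to \<open>N\<close> for the graph and the SSSP to persist.
\<close>
lemma SSSP_perturb_symplectic_eigenvalues:
  fixes N :: "('p::finite + 'p) sqmat"
  assumes N: "SSSP N" and d: "williamson_diagonal N d"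
  obtains \<epsilon> where "\<epsilon> > 0"
    "\<And>d'. \<forall>i. d' $ i > 0 \<and> \<bar>d' $ i - d $ i\<bar> \<le> \<epsilon> \<Longrightarrow>
      \<exists>N'. pos_def N' \<and> SSSP N' \<and> labeled_graph N' = labeled_graph N \<and> williamson_diagonal N' d'"
proof -
  let ?P = "pattern_projection (labeled_graph N)"
  obtain S where S: "symplectic S" "transpose S ** N ** S = doubled_diag d"
    using d by (auto simp: williamson_diagonal_def)
  obtain W where W: "symplectic W" "S ** W = mat 1" "W ** S = mat 1"
    using symplectic_inverse[OF S(1)] .
  define F where "F a = transpose W ** doubled_diag a ** W" for a
  have "F d = transpose (S ** W) ** N ** (S ** W)"
    by (simp only: F_def S(2)[symmetric] matrix_transpose_mul matrix_mul_assoc)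
  then have "F d = N" by (simp add: W)
  have dd: "doubled_diag (a + b) = doubled_diag a + doubled_diag b"
    "doubled_diag (c *\<^sub>R a) = c *\<^sub>R doubled_diag a" for a b :: "real^'p" and c
    by (auto simp: vec_eq_iff doubled_diag_entry split: sum.split)
  have "linear F"
    unfolding F_def by (intro linearI) (simp_all add: dd matrix_mult_simps matrix_mult_scaleR)
  then obtain C where C: "C > 0" "\<And>a. norm (F a) \<le> C * norm a"
    using linear_bounded_pos by blast
  obtain \<eta>1 where \<eta>1: "\<eta>1 > 0"
    "\<And>N'. pos_def N' \<Longrightarrow> labeled_graph N' = labeled_graph N \<Longrightarrow> norm (N' - N) < \<eta>1 \<Longrightarrow> SSSP N'"
    by (rule SSSP_open[OF N]) (rule that)
  obtain \<eta>2 where \<eta>2: "\<eta>2 > 0"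
    "\<And>N'. norm (N' - N) < \<eta>2 \<Longrightarrow> \<forall>i j. i \<noteq> j \<longrightarrow> N $ i $ j = 0 \<longrightarrow> N' $ i $ j = 0 \<Longrightarrow>
      labeled_graph N' = labeled_graph N"
    by (rule labeled_graph_stable[of N]) (rule that)
  have "min \<eta>1 \<eta>2 > 0" using \<eta>1(1) \<eta>2(1) by simp
  then obtain \<epsilon>0 where \<epsilon>0: "\<epsilon>0 > 0"
    "\<And>N''. N'' \<in> Symm \<Longrightarrow> norm (N'' - N) < \<epsilon>0 \<Longrightarrow>
      \<exists>T. symplectic T \<and> norm (transpose T ** N'' ** T - N) < min \<eta>1 \<eta>2 \<and>
        ?P (transpose T ** N'' ** T - N) = transpose T ** N'' ** T - N"
    using symplectic_congruence_into_pattern[OF N, of "min \<eta>1 \<eta>2"] by blast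
  define p where "p = real CARD('p)"
  have "p > 0" by (simp add: p_def)
  show thesis
  proof
    show "\<epsilon>0 / (2 * C * p) > 0" using \<epsilon>0(1) C(1) \<open>p > 0\<close> by simp
    fix d' :: "real^'p"
    assume "\<forall>i. d' $ i > 0 \<and> \<bar>d' $ i - d $ i\<bar> \<le> \<epsilon>0 / (2 * C * p)"
    then have d'_pos: "d' $ i > 0" and close: "\<bar>d' $ i - d $ i\<bar> \<le> \<epsilon>0 / (2 * C * p)" for i
      by blast+
    have "norm (d' - d) \<le> (\<Sum>i\<in>UNIV. \<bar>(d' - d) $ i\<bar>)"
      by (rule norm_le_l1_cart)
    also have "\<dots> \<le> p * (\<epsilon>0 / (2 * C * p))"
      unfolding p_def by (rule sum_bounded_above) (use close in \<open>simp add: p_def\<close>)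
    finally have "C * norm (d' - d) \<le> C * (p * (\<epsilon>0 / (2 * C * p)))"
      using C(1) by simp
    also have "\<dots> < \<epsilon>0"
      using C(1) \<open>p > 0\<close> \<epsilon>0(1) by simp
    finally have "norm (F d' - N) < \<epsilon>0"
      using C(2)[of "d' - d"] by (simp add: linear_diff[OF \<open>linear F\<close>] \<open>F d = N\<close>)
    moreover have Fd': "pos_def (F d')"
      unfolding F_def by (rule pos_def_congruence[OF pos_def_doubled_diag[OF d'_pos] W(2)])
    ultimately obtain T where T: "symplectic T" "norm (transpose T ** F d' ** T - N) < min \<eta>1 \<eta>2"
      "?P (transpose T ** F d' ** T - N) = transpose T ** F d' ** T - N"
      using \<epsilon>0(2)[of "F d'"] by (auto simp: pos_def_def)
    define N' where "N' = transpose T ** F d' ** T"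
    define V where "V = W ** T"
    have "symplectic V" unfolding V_def by (rule symplectic_mult[OF W(1) T(1)])
    then obtain V' where V': "symplectic V'" "V ** V' = mat 1" "V' ** V = mat 1"
      using symplectic_inverse by blast
    have N'_V: "N' = transpose V ** doubled_diag d' ** V"
      by (simp add: N'_def F_def V_def matrix_transpose_mul matrix_mul_assoc)
    have pd: "pos_def N'"
      unfolding N'_V by (rule pos_def_congruence[OF pos_def_doubled_diag[OF d'_pos] V'(3)])
    have zero: "N' $ i $ j = 0" if "i \<noteq> j" "N $ i $ j = 0" for i j
    proof -
      have "N $ j $ i = 0"
        using N that by (auto simp: SSSP_def pos_def_def Symm_def transpose_def vec_eq_iff)
      then have "{i, j} \<notin> labeled_graph N"
        using that by (auto simp: labeled_graph_def doubleton_eq_iff)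
      then have "?P (N' - N) $ i $ j = 0"
        using that by (simp add: pattern_projection_def)
      then show ?thesis using T(3) that by (simp add: N'_def)
    qed
    have graph: "labeled_graph N' = labeled_graph N"
      using T(2) zero by (intro \<eta>2(2)) (simp_all add: N'_def)
    have "SSSP N'"
      using T(2) by (intro \<eta>1(2) pd graph) (simp add: N'_def)
    moreover have "transpose V' ** N' ** V' = doubled_diag d'"
    proof -
      have "transpose V' ** N' ** V' = transpose (V ** V') ** doubled_diag d' ** (V ** V')"
        by (simp only: N'_V matrix_transpose_mul matrix_mul_assoc)
      then show ?thesis by (simp add: V')
    qed
    then have "williamson_diagonal N' d'"
      using V'(1) d'_pos by (auto simp: williamson_diagonal_def)
    ultimately show "\<exists>N'. pos_def N' \<and> SSSP N' \<and> labeled_graph N' = labeled_graph N \<and>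
        williamson_diagonal N' d'"
      using pd graph by blast
  qed
qed

lemma symplectic_mult_list_eq:
  fixes N :: "('p::finite + 'p) sqmat"
  assumes "williamson_diagonal N d"
  shows "symplectic_mult_list N = multiplicity_list (image_mset (($) d) (mset_set UNIV))"
  by (simp add: symplectic_mult_list_def multiplicity_list_def symplectic_eigenvalues_eq[OF assms])

lemma multiplicity_list_single_value:
  assumes "E \<noteq> {#}" "\<And>x y. x \<in># E \<Longrightarrow> y \<in># E \<Longrightarrow> x = y"
  shows "multiplicity_list E = [size E]"
proof -
  obtain x where "x \<in># E" using assms(1) by blast
  then have "set_mset E \<subseteq> {x}" using assms(2) by blast
  then have E: "E = replicate_mset (size E) x"
    by (rule set_mset_subset_singletonD)
  have "multiplicity_list (replicate_mset n x) = [n]" if "n > 0" for n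
    using that by (simp add: multiplicity_list_def)
  then show ?thesis
    using E assms(1) by (metis nonempty_has_size)
qed

lemma SSSP_realizes_refinement:
  fixes N :: "('p::finite + 'p) sqmat"
  assumes N: "SSSP N" and ref: "refinement ms (symplectic_mult_list N)"
  shows "\<exists>N' :: ('p + 'p) sqmat. pos_def N' \<and> SSSP N' \<and>
           labeled_graph N' = labeled_graph N \<and> symplectic_mult_list N' = ms"
proof -
  have "pos_def N" using N by (simp add: SSSP_def)
  then obtain d where d: "williamson_diagonal N d"
    using williamson_exists by blast
  obtain \<epsilon> where \<epsilon>: "\<epsilon> > 0"
    "\<And>d'. \<forall>i. d' $ i > 0 \<and> \<bar>d' $ i - d $ i\<bar> \<le> \<epsilon> \<Longrightarrow>
      \<exists>N'. pos_def N' \<and> SSSP N' \<and> labeled_graph N' = labeled_graph N \<and> williamson_diagonal N' d'"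
    by (rule SSSP_perturb_symplectic_eigenvalues[OF N d]) (rule that)
  have "refinement ms (multiplicity_list (image_mset (($) d) (mset_set UNIV)))"
    using ref by (simp add: symplectic_mult_list_eq[OF d])
  then obtain d' where d': "\<And>i. d $ i \<le> d' $ i" "\<And>i. d' $ i < d $ i + \<epsilon>"
    "multiplicity_list (image_mset (($) d') (mset_set UNIV)) = ms"
    using refine_multiplicities[OF _ \<epsilon>(1)] by blast
  have "d' $ i > 0" for i
    using d d'(1)[of i] by (auto simp: williamson_diagonal_def intro: less_le_trans)
  moreover have "\<bar>d' $ i - d $ i\<bar> \<le> \<epsilon>" for i
    using d'(1,2)[of i] by simp
  ultimately obtain N' where "pos_def N'" "SSSP N'" "labeled_graph N' = labeled_graph N"
    "williamson_diagonal N' d'"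
    using \<epsilon>(2) by blast
  then show ?thesis
    using d'(3) symplectic_mult_list_eq by blast
qed

theorem corollary3p19:
  fixes N :: "real^('p::finite + 'p)^('p + 'p)"
  assumes "pos_def N" and "SSSP N"
  shows "(\<forall>ms'. refinement ms' (symplectic_mult_list N) \<longrightarrow>
            (\<exists>N' :: real^('p + 'p)^('p + 'p). pos_def N' \<and> SSSP N' \<and>
               labeled_graph N' = labeled_graph N \<and> symplectic_mult_list N' = ms'))
       \<and> ((\<forall>x y. x \<in># symplectic_eigenvalues N \<and> y \<in># symplectic_eigenvalues N \<longrightarrow> x = y) \<longrightarrow>
            (\<forall>ms :: nat list. (\<forall>m\<in>set ms. m > 0) \<and> sum_list ms = CARD('p) \<longrightarrow>
               (\<exists>N' :: real^('p + 'p)^('p + 'p). pos_def N' \<and>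
                  labeled_graph N' = labeled_graph N \<and> symplectic_mult_list N' = ms)))"
proof (intro conjI allI impI)
  fix ms' assume "refinement ms' (symplectic_mult_list N)"
  then show "\<exists>N' :: real^('p + 'p)^('p + 'p). pos_def N' \<and> SSSP N' \<and>
      labeled_graph N' = labeled_graph N \<and> symplectic_mult_list N' = ms'"
    by (rule SSSP_realizes_refinement[OF assms(2)])
next
  fix ms :: "nat list"
  assume single: "\<forall>x y. x \<in># symplectic_eigenvalues N \<and> y \<in># symplectic_eigenvalues N \<longrightarrow> x = y"
    and ms: "(\<forall>m\<in>set ms. m > 0) \<and> sum_list ms = CARD('p)"
  obtain d where d: "williamson_diagonal N d"
    using williamson_exists[OF assms(1)] by blast
  define E where "E = image_mset (($) d) (mset_set UNIV)"
  have "size E = CARD('p)" by (simp add: E_def)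
  then have "E \<noteq> {#}" by auto
  moreover have "x = y" if "x \<in># E" "y \<in># E" for x y
    using single that unfolding symplectic_eigenvalues_eq[OF d] E_def[symmetric] by blast
  ultimately have "symplectic_mult_list N = [CARD('p)]"
    unfolding symplectic_mult_list_eq[OF d] E_def[symmetric] \<open>size E = CARD('p)\<close>[symmetric]
    by (rule multiplicity_list_single_value)
  with ms have "refinement ms (symplectic_mult_list N)"
    by (auto simp: refinement_def intro!: exI[of _ "[ms]"])
  then show "\<exists>N' :: real^('p + 'p)^('p + 'p). pos_def N' \<and>
      labeled_graph N' = labeled_graph N \<and> symplectic_mult_list N' = ms"
    using SSSP_realizes_refinement[OF assms(2)] by blast
qed

end
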